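(* There is a proper holomorphic submersion $\mathscr Y\to\Delta$ over a disk $\Delta\subset\mathbb C$ (with coordinate $s$, centred at $0$) whose central fibre is the resonant square fourfold $X$, and such that $$\operatorname{KS}_0(\partial_s)=\eta\in H^1(X,\Theta_X).$$
   Context: The resonant square. Let $q_0=e^{-2\pi}$, coordinates $(x,y,u,v)=(z_1,z_3,z_2,z_4)$ on $\mathbb C^4$, $U=(\mathbb C^2_{x,y}\setminus0)\times(\mathbb C^2_{u,v}\setminus0)$, and let $G\cong\mathbb Z^2$ be generated by $$g_1(x,y,u,v)=(q_0x,q_0y,u,q_0^2v),\qquad g_2(x,y,u,v)=(x,y,q_0u,q_0v).$$ $X=U/G$ is a compact complex fourfold (an LVM manifold whose visible complex is the four-cycle on $\{1,2,3,4\}$ with maximal faces $12,14,23,34$). Class $\eta$. $H^\bullet(X,\Theta_X)$ is computed by the total complex of the Koszul complex on the deck generators with coefficients in the normalized Čech complex of $\Theta_U$ for the ordered cover of $U$ by the charts $U_\sigma=\{z\in U:z_j\ne0\text{ for }j\notin\sigma\}$, $\sigma=12,14,23,34$; on Čech degree $a$, $d_{\mathrm{tot}}(c\otimes\omega)=\delta_{\check C}c\otimes\omega+(-1)^a\sum_\mu(g_\mu^*-1)c\otimes\xi_\mu\wedge\omega$, where $g^*V=(dg)^{-1}(V\circ g)$ and $\xi_1,\xi_2$ is the basis of $\operatorname{Hom}_{\mathbb Z}(G,\mathbb C)$ dual to $g_1,g_2$. Put $W=\frac{v}{xy}\,\partial_u$, which is $G$-invariant. Assign the four charts $12,14,23,34$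 the scalars $0,0,1,1$; let $c_{ij}$ be the value at $j$ minus the value at $i$. Then $\eta$ is the class of the Čech one-cocycle $(c_{ij}W)$ (with zero component in positive group degree). The Kodaira–Spencer map $\operatorname{KS}_0$ is the connecting homomorphism of $0\to\Theta_X\to\Theta_{\mathscr Y}|_X\to\mathcal O_X\otimes T_0\Delta\to0$. *)

theory Defs
  imports "HOL-Analysis.Analysis" "HOL-Library.Function_Algebras"
begin

section \<open>Complex manifolds\<close>

text \<open>Only meant for open \<open>S\<close>; complex differentiability on an open subset of
  \<open>\<complex>\<^sup>n\<close>, the derivative being a complex matrix.\<close>

definition holo_on :: "(complex^'n \<Rightarrow> complex^'m) \<Rightarrow> (complex^'n) set \<Rightarrow> bool" where
  "holo_on f S \<longleftrightarrow> (\<forall>z\<in>S. \<exists>A. (f has_derivative (\<lambda>h. A *v h)) (at z))"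

text \<open>A chart is a pair of its domain and a coordinate map; the values of the coordinate map
  outside of the domain are irrelevant.\<close>

type_synonym ('a, 'n) chart = "'a set \<times> ('a \<Rightarrow> complex^'n)"

record ('a, 'n) cmanifold =
  mtop :: "'a topology"
  atlas :: "('a, 'n) chart set"

definition chart_inv :: "('a, 'n::finite) chart \<Rightarrow> complex^'n \<Rightarrow> 'a" where
  "chart_inv c = the_inv_into (fst c) (snd c)"

definition complex_manifold :: "('a, 'n::finite) cmanifold \<Rightarrow> bool" where
  "complex_manifold M \<longleftrightarrow>
     Hausdorff_space (mtop M) \<and> second_countable (mtop M) \<and>
     (\<Union>c\<in>atlas M. fst c) = topspace (mtop M) \<and>
     (\<forall>c\<in>atlas M. openin (mtop M) (fst c) \<and> open (snd c ` fst c) \<and>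
        homeomorphic_map (subtopology (mtop M) (fst c)) (top_of_set (snd c ` fst c)) (snd c)) \<and>
     (\<forall>c\<in>atlas M. \<forall>d\<in>atlas M. holo_on (snd d \<circ> chart_inv c) (snd c ` (fst c \<inter> fst d)))"

definition holomorphic_map ::
    "('a, 'n::finite) cmanifold \<Rightarrow> ('b, 'm::finite) cmanifold \<Rightarrow> ('a \<Rightarrow> 'b) \<Rightarrow> bool" where
  "holomorphic_map M N F \<longleftrightarrow>
     complex_manifold M \<and> complex_manifold N \<and> continuous_map (mtop M) (mtop N) F \<and>
     (\<forall>c\<in>atlas M. \<forall>d\<in>atlas N.
        holo_on (snd d \<circ> F \<circ> chart_inv c) (snd c ` {x \<in> fst c. F x \<in> fst d}))"

definition charts_at :: "('a, 'n::finite) cmanifold \<Rightarrow> 'a \<Rightarrow> ('a, 'n) chart set" where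
  "charts_at M x = {c \<in> atlas M. x \<in> fst c}"

text \<open>A tangent vector at \<open>x\<close> is the family of its coordinate vectors in all charts around \<open>x\<close>,
  related by the derivatives of the transition maps. Families are set to \<open>0\<close> at all
  other charts, so that equality of families is equality of tangent vectors.\<close>

type_synonym ('a, 'n) tangent = "('a, 'n) chart \<Rightarrow> complex^'n"

definition tangent_space :: "('a, 'n::finite) cmanifold \<Rightarrow> 'a \<Rightarrow> ('a, 'n) tangent set" where
  "tangent_space M x = {t. (\<forall>c. c \<notin> charts_at M x \<longrightarrow> t c = 0) \<and>
     (\<forall>c\<in>charts_at M x. \<forall>d\<in>charts_at M x.
        t d = frechet_derivative (snd d \<circ> chart_inv c) (at (snd c x)) (t c))}"

text \<open>The differential of \<open>F\<close> at \<open>x\<close>, computed through an arbitrarily chosen chart at \<open>x\<close>; by the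
  chain rule the choice does not matter for elements of the tangent space.\<close>

definition differential ::
    "('a, 'n::finite) cmanifold \<Rightarrow> ('b, 'm::finite) cmanifold \<Rightarrow> ('a \<Rightarrow> 'b) \<Rightarrow> 'a \<Rightarrow>
       ('a, 'n) tangent \<Rightarrow> ('b, 'm) tangent" where
  "differential M N F x t =
     (let c = (SOME c. c \<in> charts_at M x) in
      (\<lambda>d. if d \<in> charts_at N (F x)
           then frechet_derivative (snd d \<circ> F \<circ> chart_inv c) (at (snd c x)) (t c) else 0))"

definition holomorphic_submersion ::
    "('a, 'n::finite) cmanifold \<Rightarrow> ('b, 'm::finite) cmanifold \<Rightarrow> ('a \<Rightarrow> 'b) \<Rightarrow> bool" where
  "holomorphic_submersion M N F \<longleftrightarrow> holomorphic_map M N F \<and>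
     (\<forall>x\<in>topspace (mtop M). differential M N F x ` tangent_space M x = tangent_space N (F x))"

definition holomorphic_embedding ::
    "('a, 'n::finite) cmanifold \<Rightarrow> ('b, 'm::finite) cmanifold \<Rightarrow> ('a \<Rightarrow> 'b) \<Rightarrow> bool" where
  "holomorphic_embedding M N F \<longleftrightarrow> holomorphic_map M N F \<and> embedding_map (mtop M) (mtop N) F \<and>
     (\<forall>x\<in>topspace (mtop M). inj_on (differential M N F x) (tangent_space M x))"

definition disk :: "real \<Rightarrow> (complex, 1) cmanifold" where
  "disk r = \<lparr>mtop = top_of_set (ball 0 r), atlas = {(ball 0 r, \<lambda>s. vec s)}\<rparr>"

text \<open>The tangent vector \<open>\<partial>\<^sub>s\<close> at the origin of the disk.\<close>

definition d_ds :: "real \<Rightarrow> (complex, 1) tangent" where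
  "d_ds r = (\<lambda>c. if c \<in> charts_at (disk r) 0 then vec 1 else 0)"


section \<open>The resonant square\<close>

text \<open>A point of \<open>\<complex>\<^sup>4\<close> is \<open>(z\<^sub>1, z\<^sub>2, z\<^sub>3, z\<^sub>4) = (x, u, y, v)\<close>.\<close>

definition q0 :: complex where
  "q0 = of_real (exp (- 2 * pi))"

definition U :: "(complex^4) set" where
  "U = {z. (z$1, z$3) \<noteq> (0, 0) \<and> (z$2, z$4) \<noteq> (0, 0)}"

text \<open>The deck generators \<open>g\<^sub>1, g\<^sub>2\<close> are the values at the indices \<open>1, 2\<close>.\<close>

definition gen :: "nat \<Rightarrow> complex^4 \<Rightarrow> complex^4" where
  "gen \<mu> z = (if \<mu> = 1 then vector [q0 * z$1, z$2, q0 * z$3, q0\<^sup>2 * z$4]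
                        else vector [z$1, q0 * z$2, z$3, q0 * z$4])"

inductive_set deck_group :: "(complex^4 \<Rightarrow> complex^4) set" where
  deck_id: "id \<in> deck_group"
| deck_gen: "h \<in> deck_group \<Longrightarrow> \<mu> \<in> {1, 2} \<Longrightarrow> gen \<mu> \<circ> h \<in> deck_group"
| deck_inv: "h \<in> deck_group \<Longrightarrow> \<mu> \<in> {1, 2} \<Longrightarrow> inv (gen \<mu>) \<circ> h \<in> deck_group"

definition orbit :: "complex^4 \<Rightarrow> (complex^4) set" where
  "orbit z = {h z | h. h \<in> deck_group}"

text \<open>The quotient \<open>X = U/G\<close> with the quotient topology; the charts are the local inverses of the
  projection.\<close>

definition X :: "((complex^4) set, 4) cmanifold" where
  "X = \<lparr>mtop = topology (\<lambda>T. T \<subseteq> orbit ` U \<and> openin (top_of_set U) {z \<in> U. orbit z \<in> T}),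
        atlas = {(orbit ` V, the_inv_into V orbit) | V. open V \<and> V \<subseteq> U \<and> inj_on orbit V}\<rparr>"


section \<open>Equivariant sheaves on \<open>U\<close> and their total complexes\<close>

text \<open>A \<open>G\<close>-equivariant sheaf on \<open>U\<close> with fibres in \<open>'v\<close>: its sections over \<open>G\<close>-stable open sets
  and the pullbacks along the deck generators. Sections are compared only on their domain.\<close>

record 'v gsheaf =
  sections :: "(complex^4) set \<Rightarrow> (complex^4 \<Rightarrow> 'v) set"
  pull :: "nat \<Rightarrow> (complex^4 \<Rightarrow> 'v) \<Rightarrow> complex^4 \<Rightarrow> 'v"

definition Theta :: "(complex^4) gsheaf" where
  "Theta = \<lparr>sections = (\<lambda>S. {V. holo_on V S}),
     pull = (\<lambda>\<mu> V z. inv (frechet_derivative (gen \<mu>) (at z)) (V (gen \<mu> z)))\<rparr>"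

text \<open>The pullback of the tangent bundle of \<open>N\<close> along a \<open>G\<close>-invariant map \<open>F\<close> from \<open>U\<close> to \<open>N\<close>.
  Because of the invariance, the fibres at \<open>z\<close> and at \<open>gen \<mu> z\<close> are the same.\<close>

definition pullback_Theta ::
    "('b, 'm::finite) cmanifold \<Rightarrow> (complex^4 \<Rightarrow> 'b) \<Rightarrow> ('b, 'm) tangent gsheaf" where
  "pullback_Theta N F = \<lparr>sections = (\<lambda>S. {b.
        (\<forall>z\<in>S. b z \<in> tangent_space N (F z)) \<and>
        (\<forall>d\<in>atlas N. holo_on (\<lambda>z. b z d) {z \<in> S. F z \<in> fst d})}),
     pull = (\<lambda>\<mu> b z. b (gen \<mu> z))\<rparr>"

definition dmap ::
    "('b, 'm::finite) cmanifold \<Rightarrow> (complex^4 \<Rightarrow> 'b) \<Rightarrow> complex^4 \<Rightarrow> complex^4 \<Rightarrow> ('b, 'm) tangent" where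
  "dmap N F z v =
     (\<lambda>d. if d \<in> charts_at N (F z) then frechet_derivative (snd d \<circ> F) (at z) v else 0)"

definition face :: "nat \<Rightarrow> 4 set" where
  "face i = [{1, 2}, {1, 4}, {2, 3}, {3, 4}] ! i"

definition chart_U :: "nat set \<Rightarrow> (complex^4) set" where
  "chart_U I = {z \<in> U. \<forall>i\<in>I. \<forall>j. j \<notin> face i \<longrightarrow> z$j \<noteq> 0}"

text \<open>A cochain \<open>c\<close> assigns to a nonempty set \<open>I\<close> of chart indices and a set \<open>M\<close> of generator
  indices the section \<open>c I M\<close> over \<open>chart_U I\<close>, the coefficient of the wedge product of the
  \<open>\<xi>\<^sub>\<mu>\<close>, \<open>\<mu> \<in> M\<close>, in increasing order. Its Cech degree is \<open>card I - 1\<close>.\<close>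

type_synonym 'v cochain = "nat set \<Rightarrow> nat set \<Rightarrow> complex^4 \<Rightarrow> 'v"

definition tot_index :: "nat \<Rightarrow> (nat set \<times> nat set) set" where
  "tot_index n = {(I, M). I \<noteq> {} \<and> I \<subseteq> {..<4} \<and> M \<subseteq> {1, 2} \<and> card I + card M = Suc n}"

definition signed :: "nat \<Rightarrow> 'v::ab_group_add \<Rightarrow> 'v" where
  "signed k x = (if even k then x else - x)"

definition position :: "nat \<Rightarrow> nat set \<Rightarrow> nat" where
  "position i I = card {j \<in> I. j < i}"

definition cochains :: "'v gsheaf \<Rightarrow> nat \<Rightarrow> 'v cochain set" where
  "cochains A n = {c. \<forall>(I, M)\<in>tot_index n. c I M \<in> sections A (chart_U I)}"

definition cochain_eq :: "nat \<Rightarrow> 'v cochain \<Rightarrow> 'v cochain \<Rightarrow> bool" where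
  "cochain_eq n c c' \<longleftrightarrow> (\<forall>(I, M)\<in>tot_index n. \<forall>z\<in>chart_U I. c I M z = c' I M z)"

text \<open>The sign \<open>(-1)\<^bsup>position \<mu> M\<^esup>\<close> is that of \<open>\<xi>\<^sub>\<mu> \<and> \<xi>\<^bsub>M - {\<mu>}\<^esub> = \<plusminus> \<xi>\<^bsub>M\<^esub>\<close>.\<close>

definition d_tot :: "'v::ab_group_add gsheaf \<Rightarrow> 'v cochain \<Rightarrow> 'v cochain" where
  "d_tot A c I M z =
     (\<Sum>i | i \<in> I \<and> I \<noteq> {i}. signed (position i I) (c (I - {i}) M z)) +
     signed (card I - 1)
       (\<Sum>\<mu>\<in>M. signed (position \<mu> M) (pull A \<mu> (c I (M - {\<mu>})) z - c I (M - {\<mu>}) z))"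

definition cocycles :: "'v::ab_group_add gsheaf \<Rightarrow> nat \<Rightarrow> 'v cochain set" where
  "cocycles A n = {c \<in> cochains A n. cochain_eq (Suc n) (d_tot A c) (\<lambda>I M z. 0)}"

text \<open>The class of a cocycle \<open>c\<close> in the cohomology of degree \<open>Suc n\<close>, as a coset.\<close>

definition coh_class :: "'v::ab_group_add gsheaf \<Rightarrow> nat \<Rightarrow> 'v cochain \<Rightarrow> 'v cochain set" where
  "coh_class A n c = {c' \<in> cocycles A (Suc n).
     \<exists>a\<in>cochains A n. cochain_eq (Suc n) c' (\<lambda>I M z. c I M z + d_tot A a I M z)}"

text \<open>The connecting homomorphism of a short exact sequence given by fibrewise maps
  \<open>\<alpha>\<close> from \<open>A\<close> to \<open>B\<close> and \<open>\<beta>\<close> from \<open>B\<close> to the third sheaf, applied to the class of the cocycle \<open>\<gamma>\<close>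
  of degree \<open>n\<close>. Letting the lift \<open>b\<close> of \<open>\<gamma>\<close> vary yields a full coset of coboundaries; without any
  lift the result would be empty, hence not a cohomology class.\<close>

definition connecting ::
    "'v::ab_group_add gsheaf \<Rightarrow> 'w::ab_group_add gsheaf \<Rightarrow> (complex^4 \<Rightarrow> 'v \<Rightarrow> 'w) \<Rightarrow>
     (complex^4 \<Rightarrow> 'w \<Rightarrow> 'x) \<Rightarrow> nat \<Rightarrow> 'x cochain \<Rightarrow> 'v cochain set" where
  "connecting A B \<alpha> \<beta> n \<gamma> = {c \<in> cocycles A (Suc n). \<exists>b\<in>cochains B n.
     cochain_eq n (\<lambda>I M z. \<beta> z (b I M z)) \<gamma> \<and>
     cochain_eq (Suc n) (\<lambda>I M z. \<alpha> z (c I M z)) (d_tot B b)}"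

text \<open>The Kodaira--Spencer map at \<open>0\<close> of a family \<open>p\<close> from \<open>Y\<close> to \<open>disk r\<close> with central fibre
  \<open>\<iota> ` X\<close>, for a tangent vector \<open>t\<close> of the disk at \<open>0\<close>. All sheaves on \<open>X\<close> are pulled back
  to \<open>U\<close>; the section \<open>1 \<otimes> t\<close> becomes the constant section \<open>t\<close>.\<close>

definition KS ::
    "('b, 'm::finite) cmanifold \<Rightarrow> real \<Rightarrow> ('b \<Rightarrow> complex) \<Rightarrow> ((complex^4) set \<Rightarrow> 'b) \<Rightarrow>
       (complex, 1) tangent \<Rightarrow> (complex^4) cochain set" where
  "KS Y r p \<iota> t = connecting Theta (pullback_Theta Y (\<iota> \<circ> orbit))
     (dmap Y (\<iota> \<circ> orbit)) (\<lambda>z. differential Y (disk r) p (\<iota> (orbit z))) 0 (\<lambda>I M z. t)"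


section \<open>The class \<open>\<eta>\<close>\<close>

text \<open>The vector field \<open>v/(xy) \<partial>\<^sub>u\<close>.\<close>

definition W :: "complex^4 \<Rightarrow> complex^4" where
  "W z = vector [0, z$4 / (z$1 * z$3), 0, 0]"

definition chart_scalar :: "nat \<Rightarrow> complex" where
  "chart_scalar i = [0, 0, 1, 1] ! i"

text \<open>Only the components of total degree \<open>1\<close> matter, for which \<open>M = {}\<close> means \<open>I = {i, j}\<close>,
  \<open>i < j\<close>.\<close>

definition eta_cocycle :: "(complex^4) cochain" where
  "eta_cocycle I M z =
     (if M = {} then (chart_scalar (Max I) - chart_scalar (Min I)) *s W z else 0)"

definition eta :: "(complex^4) cochain set" where
  "eta = coh_class Theta 0 eta_cocycle"

end

theory Submission
  imports Defs
begin

text \<open>The class of \<open>\<eta>\<close> comes from \<open>1 / (x y) \<in> H\<^sup>1(\<complex>\<^sup>2 - 0, \<O>)\<close>: gluing \<open>{y \<noteq> 0} \<times> \<Delta>\<close> to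
  \<open>{x \<noteq> 0} \<times> \<Delta>\<close> along the flow \<open>u \<mapsto> u - s v / (x y)\<close> of \<open>- W\<close> deforms \<open>U\<close>, and the
  deck group acts on the result because \<open>W\<close> is invariant. The class \<open>1 / (x y)\<close> splits
  smoothly and invariantly, hence the quotient is \<open>X \<times> \<Delta>\<close> as a topological space, and only its
  holomorphic charts are deformed; properness is then the compactness of \<open>X\<close>. The coordinate fields
  \<open>\<partial>\<^sub>s\<close> of the two kinds of charts lift \<open>\<partial>\<^sub>s\<close> and differ by \<open>W\<close> on the central fibre.\<close>

text \<open>Resonance is what makes \<open>W\<close> invariant: under \<open>g_1\<close> the weight
  \<open>q0^2\<close> of \<open>v\<close> is that of the product \<open>x y\<close>, and under
  \<open>g_2\<close> both \<open>u\<close> and \<open>v\<close> have weight \<open>q0\<close>, so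
  \<open>v/(xy)\<close> transforms exactly like \<open>u\<close>. A space glued from two pieces
  would leave separation, countability and compactness of the fibres to be checked by hand. The
  smooth trivialization transports all of them from the product. It is invertible by an explicit
  formula because the twist changes only \<open>u\<close> and does not depend on \<open>u\<close>.
  On the cohomological side, the coordinate fields of the two kinds of charts have as total
  coboundary the given cocycle itself, with no correction term: they are invariant under the deck
  group, and their two domains contain the Cech charts with scalar \<open>0\<close> and those with
  scalar \<open>1\<close>. Since both classes are sets of cocycles, equality also demands that every
  other lift of the base vector field differ from this one by a holomorphic cochain of vector fields
  on \<open>U\<close>, that is, exactness of the sequence on sections.\<close>

section \<open>Vectors with four and five entries\<close>

lemma vector_4 [simp]:
  "(vector [x1, x2, x3, x4] :: ('a::zero)^4) $ 1 = x1"
  "(vector [x1, x2, x3, x4] :: ('a::zero)^4) $ 2 = x2"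
  "(vector [x1, x2, x3, x4] :: ('a::zero)^4) $ 3 = x3"
  "(vector [x1, x2, x3, x4] :: ('a::zero)^4) $ 4 = x4"
  unfolding vector_def by simp_all

lemma vector_5 [simp]:
  "(vector [x1, x2, x3, x4, x5] :: ('a::zero)^5) $ 1 = x1"
  "(vector [x1, x2, x3, x4, x5] :: ('a::zero)^5) $ 2 = x2"
  "(vector [x1, x2, x3, x4, x5] :: ('a::zero)^5) $ 3 = x3"
  "(vector [x1, x2, x3, x4, x5] :: ('a::zero)^5) $ 4 = x4"
  "(vector [x1, x2, x3, x4, x5] :: ('a::zero)^5) $ 5 = x5"
  unfolding vector_def by simp_all

lemma exhaust_5:
  fixes x :: 5
  shows "x = 1 \<or> x = 2 \<or> x = 3 \<or> x = 4 \<or> x = 5"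
proof (induct x)
  case (of_int z)
  \<comment> \<open>The residue \<open>0\<close> is the index \<open>5\<close>, since
    \<open>5 = 0\<close> in this type.\<close>
  then have "z = 0 \<or> z = 1 \<or> z = 2 \<or> z = 3 \<or> z = 4" by fastforce
  then show ?case by auto
qed

lemma forall_5: "(\<forall>i::5. P i) \<longleftrightarrow> P 1 \<and> P 2 \<and> P 3 \<and> P 4 \<and> P 5"
  by (metis exhaust_5)

lemma vec4_eq_iff: "(z::'a^4) = w \<longleftrightarrow> z$1 = w$1 \<and> z$2 = w$2 \<and> z$3 = w$3 \<and> z$4 = w$4"
  by (simp add: vec_eq_iff forall_4)

lemma vec5_eq_iff: "(z::'a^5) = w \<longleftrightarrow> z$1 = w$1 \<and> z$2 = w$2 \<and> z$3 = w$3 \<and> z$4 = w$4 \<and> z$5 = w$5"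
  by (simp add: vec_eq_iff forall_5)

lemma continuous_on_vector_4 [continuous_intros]:
  fixes f1 :: "'a::topological_space \<Rightarrow> 'b::{topological_space, zero}"
  assumes "continuous_on S f1" "continuous_on S f2" "continuous_on S f3" "continuous_on S f4"
  shows "continuous_on S (\<lambda>x. vector [f1 x, f2 x, f3 x, f4 x] :: 'b^4)"
proof -
  have "continuous_on S (\<lambda>x. \<chi> i. (vector [f1 x, f2 x, f3 x, f4 x] :: 'b^4) $ i)"
    by (rule continuous_on_vec_lambda, metis (mono_tags, lifting) assms continuous_on_cong exhaust_4 vector_4)
  then show ?thesis by simp
qed

lemma continuous_on_vector_5 [continuous_intros]:
  fixes f1 :: "'a::topological_space \<Rightarrow> 'b::{topological_space, zero}"
  assumes "continuous_on S f1" "continuous_on S f2" "continuous_on S f3" "continuous_on S f4" "continuous_on S f5"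
  shows "continuous_on S (\<lambda>x. vector [f1 x, f2 x, f3 x, f4 x, f5 x] :: 'b^5)"
proof -
  have "continuous_on S (\<lambda>x. \<chi> i. (vector [f1 x, f2 x, f3 x, f4 x, f5 x] :: 'b^5) $ i)"
    by (rule continuous_on_vec_lambda, metis (mono_tags, lifting) assms continuous_on_cong exhaust_5 vector_5)
  then show ?thesis by simp
qed


section \<open>The deck group\<close>

text \<open>Integer powers of \<open>q0\<close>, through the real exponential so that negative
  exponents, norms and conjugates need no separate treatment.\<close>

definition q_pow :: "int \<Rightarrow> complex" where
  "q_pow a = of_real (exp (- 2 * pi * of_int a))"

lemma q_pow_nz [simp]: "q_pow a \<noteq> 0"
  by (simp add: q_pow_def)

lemma q_pow_0 [simp]: "q_pow 0 = 1"
  by (simp add: q_pow_def)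

lemma q_pow_add: "q_pow (a + b) = q_pow a * q_pow b"
proof -
  have "- 2 * pi * of_int (a + b) = - 2 * pi * of_int a + - 2 * pi * of_int b"
    by (simp add: algebra_simps)
  then show ?thesis by (simp only: q_pow_def exp_add of_real_mult)
qed

lemma q_pow_1: "q_pow 1 = q0"
  by (simp add: q_pow_def q0_def)

lemma q_pow_2: "q_pow 2 = q0\<^sup>2"
  using q_pow_add[of 1 1] by (simp add: q_pow_1 power2_eq_square)

lemma cnj_q_pow [simp]: "cnj (q_pow a) = q_pow a"
  by (simp add: q_pow_def)

lemma cmod_q_pow: "cmod (q_pow a) = exp (- 2 * pi * of_int a)"
  by (simp add: q_pow_def)

lemma cmod_q_pow_squared: "(cmod (q_pow a))\<^sup>2 = exp (- 4 * pi * of_int a)"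
  by (simp add: cmod_q_pow flip: exp_double)

text \<open>The element \<open>g_1^a g_2^b\<close>; the exponent \<open>2 * a + b\<close> collects
  the weights \<open>q0^2\<close> and \<open>q0\<close> of \<open>v\<close>.\<close>

definition deck :: "int \<Rightarrow> int \<Rightarrow> complex^4 \<Rightarrow> complex^4" where
  "deck a b z = vector [q_pow a * z$1, q_pow b * z$2, q_pow a * z$3, q_pow (2 * a + b) * z$4]"

lemma deck_nth [simp]:
  "deck a b z $ 1 = q_pow a * z$1" "deck a b z $ 2 = q_pow b * z$2"
  "deck a b z $ 3 = q_pow a * z$3" "deck a b z $ 4 = q_pow (2 * a + b) * z$4"
  by (simp_all add: deck_def)

lemma deck_deck [simp]: "deck a b (deck c d z) = deck (a + c) (b + d) z"
proof -
  have "2 * (a + c) + (b + d) = (2 * a + b) + (2 * c + d)" by simp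
  then have "q_pow (2 * (a + c) + (b + d)) = q_pow (2 * a + b) * q_pow (2 * c + d)" by (simp only: q_pow_add)
  then show ?thesis by (simp add: vec4_eq_iff q_pow_add)
qed

lemma deck_0 [simp]: "deck 0 0 z = z"
  by (simp add: vec4_eq_iff)

lemma gen_eq_deck: "gen 1 = deck 1 0" "gen 2 = deck 0 1"
  by (auto simp: gen_def fun_eq_iff vec4_eq_iff q_pow_1 q_pow_2)

lemma inv_deck: "inv (deck a b) = deck (- a) (- b)"
  by (rule inv_equality) auto

text \<open>The generators commute, so a word in them and their inverses depends only on its two
  exponent sums. Conversely, every point of \<open>Z^2\<close> is reached from the origin by unit
  steps along the axes.\<close>

lemma deck_group_eq: "deck_group = {deck a b | a b. True}"
proof (intro equalityI subsetI)
  fix h assume "h \<in> deck_group"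
  then show "h \<in> {deck a b | a b. True}"
  proof induction
    case deck_id
    have "id = deck 0 0" by (auto simp: fun_eq_iff)
    then show ?case by blast
  next
    case (deck_gen h \<mu>)
    then obtain a b where "h = deck a b" by blast
    then have "deck c d \<circ> h = deck (c + a) (d + b)" for c d by (simp add: fun_eq_iff)
    then have "gen 1 \<circ> h \<in> {deck a b | a b. True}" "gen 2 \<circ> h \<in> {deck a b | a b. True}"
      unfolding gen_eq_deck by blast+
    then show ?case using deck_gen(2) by blast
  next
    case (deck_inv h \<mu>)
    then obtain a b where "h = deck a b" by blast
    then have "deck c d \<circ> h = deck (c + a) (d + b)" for c d by (simp add: fun_eq_iff)
    then have "inv (gen 1) \<circ> h \<in> {deck a b | a b. True}" "inv (gen 2) \<circ> h \<in> {deck a b | a b. True}"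
      unfolding gen_eq_deck inv_deck by blast+
    then show ?case using deck_inv(2) by blast
  qed
next
  have step: "deck (c + a) (d + b) \<in> deck_group"
    if "deck a b \<in> deck_group" "(c, d) \<in> {(1, 0), (0, 1), (-1, 0), (0, -1)}" for a b c d
  proof -
    have eq: "deck (c + a) (d + b) = deck c d \<circ> deck a b" by (simp add: fun_eq_iff)
    show ?thesis
      using that deck_gen[of _ 1] deck_gen[of _ 2] deck_inv[of _ 1] deck_inv[of _ 2]
      unfolding eq by (auto simp: gen_eq_deck gen_eq_deck[simplified] inv_deck)
  qed
  have "deck 0 0 = id" by (simp add: fun_eq_iff)
  then have 0: "deck 0 0 \<in> deck_group" using deck_id by simp
  have 1: "deck a 0 \<in> deck_group" for a
  proof (induction a rule: int_induct[where k = 0])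
    case base show ?case by (rule 0)
  next
    case (step1 i) then show ?case using step[of i 0 1 0] by (simp add: add.commute)
  next
    case (step2 i) then show ?case using step[of i 0 "-1" 0] by simp
  qed
  fix h assume "h \<in> {deck a b | a b. True}"
  then obtain a b where h: "h = deck a b" by blast
  have "deck a b \<in> deck_group"
  proof (induction b rule: int_induct[where k = 0])
    case base show ?case by (rule 1)
  next
    case (step1 i) then show ?case using step[of a i 0 1] by (simp add: add.commute)
  next
    case (step2 i) then show ?case using step[of a i 0 "-1"] by simp
  qed
  then show "h \<in> deck_group" using h by simp
qed

lemma orbit_eq: "orbit z = {deck a b z | a b. True}"
  unfolding orbit_def deck_group_eq by blast

lemma orbit_eq_iff: "orbit z = orbit w \<longleftrightarrow> (\<exists>a b. w = deck a b z)"
proof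
  assume "orbit z = orbit w"
  moreover have "w \<in> orbit w" unfolding orbit_eq by (metis (mono_tags, lifting) deck_0 mem_Collect_eq)
  ultimately have "w \<in> {deck a b z | a b. True}" by (metis orbit_eq)
  then show "\<exists>a b. w = deck a b z" by blast
next
  assume "\<exists>a b. w = deck a b z"
  then obtain a b where w: "w = deck a b z" by blast
  have "deck c d w = deck (c + a) (d + b) z" "deck c d z = deck (c - a) (d - b) w" for c d
    by (simp_all add: w)
  then show "orbit z = orbit w" unfolding orbit_eq by (auto; metis)
qed

lemma orbit_deck [simp]: "orbit (deck a b z) = orbit z"
  using orbit_eq_iff by metis

lemma continuous_on_deck [continuous_intros]:
  "continuous_on S f \<Longrightarrow> continuous_on S (\<lambda>x. deck a b (f x))"
  unfolding deck_def by (intro continuous_intros)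

lemma deck_in_U [simp]: "deck a b z \<in> U \<longleftrightarrow> z \<in> U"
  by (auto simp: U_def)

section \<open>Invariant norms and their logarithms\<close>

definition R2 :: "complex^4 \<Rightarrow> real" where
  "R2 z = (cmod (z$1))\<^sup>2 + (cmod (z$3))\<^sup>2"

definition S2 :: "complex^4 \<Rightarrow> real" where
  "S2 z = (cmod (z$2))\<^sup>2 + (cmod (z$4))\<^sup>2 / (R2 z)\<^sup>2"

lemma R2_pos: "z \<in> U \<Longrightarrow> R2 z > 0"
  by (auto simp: U_def R2_def add_nonneg_pos add_pos_nonneg)

lemma S2_pos: "z \<in> U \<Longrightarrow> S2 z > 0"
  using R2_pos[of z] by (auto simp: U_def S2_def add_nonneg_pos add_pos_nonneg)

lemma U_iff: "z \<in> U \<longleftrightarrow> R2 z > 0 \<and> (cmod (z$2))\<^sup>2 + (cmod (z$4))\<^sup>2 > 0"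
  by (auto simp: U_def R2_def sum_power2_gt_zero_iff)

lemma open_U: "open U"
proof -
  have "U = {z. 0 < R2 z} \<inter> {z. 0 < (cmod (z$2))\<^sup>2 + (cmod (z$4))\<^sup>2}"
    using U_iff by auto
  moreover have "open \<dots>"
    unfolding R2_def by (intro open_Int open_Collect_less continuous_intros)
  ultimately show ?thesis by simp
qed

lemma R2_deck: "R2 (deck a b z) = exp (- 4 * pi * of_int a) * R2 z"
  by (simp add: R2_def norm_mult power_mult_distrib cmod_q_pow_squared distrib_left)

lemma S2_deck: "z \<in> U \<Longrightarrow> S2 (deck a b z) = exp (- 4 * pi * of_int b) * S2 z"
proof -
  assume "z \<in> U"
  then have R: "R2 z > 0" by (rule R2_pos)
  have e: "exp (- 4 * pi * of_int (2 * a + b)) = (exp (- 4 * pi * of_int a))\<^sup>2 * exp (- 4 * pi * of_int b)"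
    by (simp add: algebra_simps flip: exp_add exp_double)
  show ?thesis
    unfolding S2_def R2_deck deck_nth norm_mult power_mult_distrib cmod_q_pow_squared e
    using R by (simp add: distrib_left)
qed

text \<open>The logarithms turn the deck group into translations by \<open>\<int>\<^sup>2\<close>; the weight of \<open>v\<close> under
  \<open>g\<^sub>1\<close> is compensated by the factor \<open>(R2 z)\<^sup>2\<close> in \<open>S2\<close>.\<close>

definition L1 :: "complex^4 \<Rightarrow> real" where
  "L1 z = - ln (R2 z) / (4 * pi)"

definition L2 :: "complex^4 \<Rightarrow> real" where
  "L2 z = - ln (S2 z) / (4 * pi)"

lemma L1_deck: "z \<in> U \<Longrightarrow> L1 (deck a b z) = L1 z + of_int a"
  using R2_pos[of z] by (simp add: L1_def R2_deck ln_mult field_simps)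

lemma L2_deck: "z \<in> U \<Longrightarrow> L2 (deck a b z) = L2 z + of_int b"
  using S2_pos[of z] by (simp add: L2_def S2_deck ln_mult field_simps)

lemma continuous_on_R2: "continuous_on S R2"
  unfolding R2_def by (intro continuous_intros)

lemma continuous_on_S2: "continuous_on U S2"
  unfolding S2_def using R2_pos by (intro continuous_intros continuous_on_R2) force

lemma continuous_on_L1: "continuous_on U L1"
  unfolding L1_def using R2_pos by (intro continuous_intros continuous_on_R2) force+

lemma continuous_on_L2: "continuous_on U L2"
  unfolding L2_def using S2_pos by (intro continuous_intros continuous_on_S2) force+

text \<open>Where \<open>L1\<close> and \<open>L2\<close> each stay in an open interval of length
  \<open>1\<close>, two points of one orbit differ by an integer translation of size less than
  \<open>1\<close> in both directions, hence coincide.\<close>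

lemma orbit_locally_inj:
  assumes "z0 \<in> U"
  obtains V where "open V" "z0 \<in> V" "V \<subseteq> U" "inj_on orbit V"
proof -
  define V where "V = (U \<inter> L1 -` {L1 z0 - 1/2 <..< L1 z0 + 1/2}) \<inter> (U \<inter> L2 -` {L2 z0 - 1/2 <..< L2 z0 + 1/2})"
  have "open V"
    unfolding V_def by (intro open_Int continuous_open_preimage continuous_on_L1 continuous_on_L2 open_U) auto
  moreover have "inj_on orbit V"
  proof (rule inj_onI)
    fix z w assume zw: "z \<in> V" "w \<in> V" "orbit z = orbit w"
    then obtain a b where w: "w = deck a b z" using orbit_eq_iff by blast
    then have "\<bar>real_of_int a\<bar> < 1" "\<bar>real_of_int b\<bar> < 1"
      using zw L1_deck[of z a b] L2_deck[of z a b] by (auto simp: V_def)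
    then have "a = 0" "b = 0" by linarith+
    then show "z = w" using w by simp
  qed
  ultimately show ?thesis using that[of V] assms by (auto simp: V_def)
qed

section \<open>The topology of \<open>X\<close>\<close>

text \<open>The constructor \<open>topology\<close> can be unfolded only once its argument is known
  to be a topology; all facts about \<open>mtop X\<close> start from here.\<close>

lemma openin_X: "openin (mtop X) T \<longleftrightarrow> T \<subseteq> orbit ` U \<and> openin (top_of_set U) {z \<in> U. orbit z \<in> T}"
proof -
  have "istopology (\<lambda>T. T \<subseteq> orbit ` U \<and> openin (top_of_set U) {z \<in> U. orbit z \<in> T})"
    unfolding istopology_def
  proof (intro conjI allI impI)
    fix S T assume "S \<subseteq> orbit ` U \<and> openin (top_of_set U) {z \<in> U. orbit z \<in> S}"
      "T \<subseteq> orbit ` U \<and> openin (top_of_set U) {z \<in> U. orbit z \<in> T}"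
    moreover have "{z \<in> U. orbit z \<in> S \<inter> T} = {z \<in> U. orbit z \<in> S} \<inter> {z \<in> U. orbit z \<in> T}" by auto
    ultimately show "S \<inter> T \<subseteq> orbit ` U" "openin (top_of_set U) {z \<in> U. orbit z \<in> S \<inter> T}" by auto
  next
    fix K assume "\<forall>T\<in>K. T \<subseteq> orbit ` U \<and> openin (top_of_set U) {z \<in> U. orbit z \<in> T}"
    moreover have "{z \<in> U. orbit z \<in> \<Union>K} = (\<Union>T\<in>K. {z \<in> U. orbit z \<in> T})" by auto
    ultimately show "\<Union>K \<subseteq> orbit ` U" "openin (top_of_set U) {z \<in> U. orbit z \<in> \<Union>K}" by auto
  qed
  then show ?thesis by (simp add: X_def topology_inverse')
qed

lemma topspace_X: "topspace (mtop X) = orbit ` U"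
proof
  show "topspace (mtop X) \<subseteq> orbit ` U" using openin_X openin_topspace by blast
  have "{z \<in> U. orbit z \<in> orbit ` U} = U" by auto
  then have "openin (mtop X) (orbit ` U)" unfolding openin_X by simp
  then show "orbit ` U \<subseteq> topspace (mtop X)" by (rule openin_subset)
qed

lemma quotient_map_orbit: "quotient_map (top_of_set U) (mtop X) orbit"
  unfolding quotient_map_def using openin_X topspace_X by auto

lemma continuous_map_orbit: "continuous_map (top_of_set U) (mtop X) orbit"
  by (simp add: quotient_imp_continuous_map quotient_map_orbit)

text \<open>The saturation of \<open>V\<close> is the union of its translates, each of which is
  open.\<close>

lemma openin_orbit_image:
  assumes "open V" "V \<subseteq> U"
  shows "openin (mtop X) (orbit ` V)"
proof -
  have eq: "{z \<in> U. orbit z \<in> orbit ` V} = (\<Union>a b. U \<inter> deck a b -` V)"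
    using assms(2) by (auto simp: orbit_eq_iff image_iff)
  have "open (U \<inter> deck a b -` V)" for a b
    by (intro continuous_open_preimage open_U assms continuous_on_deck continuous_on_id)
  then have "open (\<Union>a b. U \<inter> deck a b -` V)" by blast
  then show ?thesis unfolding openin_X eq using assms by (auto simp: open_U openin_open_eq)
qed

lemma open_map_orbit: "open_map (top_of_set U) (mtop X) orbit"
  by (auto simp: open_map_def openin_open_eq[OF open_U] intro: openin_orbit_image)

lemma second_countable_top_of_set: "second_countable (top_of_set (S :: 'a::second_countable_topology set))"
proof (rule second_countable_subtopology)
  obtain B :: "'a set set" where "countable B" "topological_basis B"
    using ex_countable_basis by blast
  then show "second_countable (euclidean :: 'a topology)"
    unfolding second_countable_def by (metis open_openin topological_basisE topological_basis_open)
qed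

lemma second_countable_X: "second_countable (mtop X)"
  by (rule second_countable_open_map_image[OF continuous_map_orbit open_map_orbit])
    (simp_all add: topspace_X second_countable_top_of_set)

text \<open>The \<open>G\<close>-invariant map to \<open>S\<^sup>3 \<times> S\<^sup>3 \<times> S\<^sup>1 \<times> S\<^sup>1\<close> whose fibres are the orbits.\<close>

definition orbit_inv :: "complex^4 \<Rightarrow> (complex^4) \<times> complex \<times> complex" where
  "orbit_inv z = (vector [z$1 / sqrt (R2 z), z$2 / sqrt (S2 z), z$3 / sqrt (R2 z), z$4 / (R2 z * sqrt (S2 z))],
     cis (2 * pi * L1 z), cis (2 * pi * L2 z))"

lemma sqrt_exp: "sqrt (exp x) = exp (x / 2)"
  by (rule real_sqrt_unique) (simp_all flip: exp_double)

lemma orbit_inv_deck: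
  assumes "z \<in> U" shows "orbit_inv (deck a b z) = orbit_inv z"
proof -
  have per: "cis (2 * pi * (x + of_int n)) = cis (2 * pi * x)" for x n
    by (simp add: distrib_left flip: cis_mult)
  have s: "sqrt (exp (- 4 * pi * of_int c)) = exp (- 2 * pi * of_int c)" for c
    by (simp add: sqrt_exp)
  \<comment> \<open>The modulus of \<open>v\<close> scales by the factors of \<open>R2\<close> and
    of \<open>sqrt (S2 z)\<close> together, which is the denominator under \<open>z$4\<close> in
    \<open>orbit_inv\<close>.\<close>
  have q4: "q_pow (2 * a + b) = of_real (exp (- 4 * pi * of_int a) * exp (- 2 * pi * of_int b))"
    by (simp add: q_pow_def algebra_simps flip: exp_add)
  show ?thesis
    using R2_pos[OF assms] S2_pos[OF assms]
    by (simp add: orbit_inv_def L1_deck L2_deck assms per R2_deck S2_deck vec4_eq_iff real_sqrt_mult s[simplified] q4)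
       (simp add: q_pow_def)
qed

lemma cis_eq_imp_int:
  assumes "cis (2 * pi * x) = cis (2 * pi * y)"
  obtains n :: int where "x = y + of_int n"
proof -
  have "sin (2 * pi * x) = sin (2 * pi * y) \<and> cos (2 * pi * x) = cos (2 * pi * y)"
    using assms by (simp add: complex_eq_iff)
  then obtain n :: int where "2 * pi * x = 2 * pi * y + 2 * pi * n"
    by (auto simp: sin_cos_eq_iff)
  then have "2 * pi * x = 2 * pi * (y + of_int n)" by (simp add: algebra_simps)
  then have "x = y + of_int n" by simp
  then show ?thesis by (rule that)
qed

text \<open>The circle components yield the integers of a deck transformation. After applying it,
  \<open>R2\<close> and \<open>S2\<close> agree at the two points, so the normalized coordinates
  determine the coordinates themselves.\<close>

lemma orbit_inv_eq_imp:
  assumes "z \<in> U" "w \<in> U" "orbit_inv z = orbit_inv w"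
  shows "orbit z = orbit w"
proof -
  obtain a :: int where a: "L1 w = L1 z + of_int a"
    using assms(3) cis_eq_imp_int[of "L1 w" "L1 z"] by (auto simp: orbit_inv_def)
  obtain b :: int where b: "L2 w = L2 z + of_int b"
    using assms(3) cis_eq_imp_int[of "L2 w" "L2 z"] by (auto simp: orbit_inv_def)
  define z' where "z' = deck a b z"
  have z': "z' \<in> U" using assms(1) by (simp add: z'_def)
  have "L1 w = L1 z'" "L2 w = L2 z'" using assms(1) a b by (simp_all add: z'_def L1_deck L2_deck)
  then have R: "R2 w = R2 z'" and S: "S2 w = S2 z'"
    using R2_pos[OF z'] S2_pos[OF z'] R2_pos[OF assms(2)] S2_pos[OF assms(2)]
    by (simp_all add: L1_def L2_def)
  have "orbit_inv z' = orbit_inv w" using assms orbit_inv_deck by (simp add: z'_def)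
  then have "z' = w" using R S R2_pos[OF z'] S2_pos[OF z'] by (auto simp: orbit_inv_def vec4_eq_iff)
  then show ?thesis by (auto simp: z'_def)
qed

lemma continuous_on_orbit_inv: "continuous_on U orbit_inv"
  unfolding orbit_inv_def using R2_pos S2_pos
  by (intro continuous_intros continuous_on_R2 continuous_on_S2 continuous_on_L1 continuous_on_L2)
     (auto simp: less_le)

text \<open>The invariant map descends to a continuous injection of \<open>X\<close> into a
  Hausdorff space, and separation pulls back.\<close>

lemma Hausdorff_X: "Hausdorff_space (mtop X)"
proof (rule quotient_map_lift_exists[OF quotient_map_orbit, of euclidean orbit_inv])
  show "continuous_map (top_of_set U) euclidean orbit_inv"
    by (simp add: continuous_on_orbit_inv)
  show "orbit_inv z = orbit_inv w"
    if "z \<in> topspace (top_of_set U)" "w \<in> topspace (top_of_set U)" "orbit z = orbit w" for z w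
    using that by (auto simp: orbit_eq_iff orbit_inv_deck)
next
  fix g assume g: "continuous_map (mtop X) euclidean g"
    "\<And>z. z \<in> topspace (top_of_set U) \<Longrightarrow> g (orbit z) = orbit_inv z"
  have "inj_on g (topspace (mtop X))"
  proof (rule inj_onI)
    fix A B assume "A \<in> topspace (mtop X)" "B \<in> topspace (mtop X)" "g A = g B"
    then obtain z w where "z \<in> U" "w \<in> U" "A = orbit z" "B = orbit w"
      unfolding topspace_X by blast
    then show "A = B" using \<open>g A = g B\<close> g(2) orbit_inv_eq_imp[of z w] by simp
  qed
  then show ?thesis using Hausdorff_space_injective_preimage[OF _ g(1)] Hausdorff_space_euclidean by blast
qed

text \<open>\<open>X\<close> is the image of a compact set \<open>K\<close> that meets every orbit:
  the points where \<open>L1\<close> and \<open>L2\<close> lie in \<open>[0, 1]\<close>.\<close>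

lemma compact_space_X: "compact_space (mtop X)"
proof -
  \<comment> \<open>This is \<open>|q0|^2\<close>, the factor by which \<open>g_1\<close> scales
    \<open>R2\<close> and \<open>g_2\<close> scales \<open>S2\<close>.\<close>
  define \<rho> where "\<rho> = exp (- 4 * pi)"
  have \<rho>: "\<rho> > 0" by (simp add: \<rho>_def)
  \<comment> \<open>The bounds on \<open>S2\<close> are cleared of their denominator, which makes
    them closed conditions on all of \<open>C^4\<close>, including \<open>R2 z = 0\<close>.\<close>
  define K where "K = {z::complex^4. \<rho> \<le> R2 z \<and> R2 z \<le> 1 \<and>
     \<rho> * (R2 z)\<^sup>2 \<le> (cmod (z$2))\<^sup>2 * (R2 z)\<^sup>2 + (cmod (z$4))\<^sup>2 \<and>
     (cmod (z$2))\<^sup>2 * (R2 z)\<^sup>2 + (cmod (z$4))\<^sup>2 \<le> (R2 z)\<^sup>2}"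
  have K_iff: "z \<in> K \<longleftrightarrow> \<rho> \<le> R2 z \<and> R2 z \<le> 1 \<and> \<rho> \<le> S2 z \<and> S2 z \<le> 1" if "R2 z > 0" for z
    using that by (auto simp: K_def S2_def field_simps)
  have KU: "K \<subseteq> U"
  proof
    fix z assume z: "z \<in> K"
    then have R: "R2 z > 0" using \<rho> by (auto simp: K_def)
    then have "\<rho> * (R2 z)\<^sup>2 > 0" using \<rho> by simp
    then have "z$2 \<noteq> 0 \<or> z$4 \<noteq> 0" using z by (auto simp: K_def)
    then show "z \<in> U" using R by (simp add: U_iff sum_power2_gt_zero_iff)
  qed
  have "closed K"
    unfolding K_def by (intro closed_Collect_conj closed_Collect_le continuous_intros continuous_on_R2)
  moreover have "bounded K"
    unfolding bounded_iff
  proof (intro exI ballI)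
    fix z assume "z \<in> K"
    then have R: "0 < R2 z" "R2 z \<le> 1" and S: "S2 z \<le> 1"
      using K_iff[of z] \<rho> by (auto simp: K_def)
    have "(cmod (z$1))\<^sup>2 \<le> 1" "(cmod (z$3))\<^sup>2 \<le> 1"
      using R unfolding R2_def by (smt (verit) zero_le_power2)+
    moreover have "0 \<le> (cmod (z$4))\<^sup>2 / (R2 z)\<^sup>2" by simp
    then have "(cmod (z$2))\<^sup>2 \<le> 1" "(cmod (z$4))\<^sup>2 / (R2 z)\<^sup>2 \<le> 1"
      using S unfolding S2_def by (smt (verit) zero_le_power2)+
    moreover from this have "(cmod (z$4))\<^sup>2 \<le> 1"
      using R by (simp add: abs_square_le_1 flip: power_divide)
    ultimately have "cmod (z$i) \<le> 1" for i
      using exhaust_4[of i] by (auto simp: abs_square_le_1)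
    then have "(\<Sum>i\<in>UNIV. cmod (z$i)) \<le> (\<Sum>i\<in>(UNIV::4 set). 1)" by (intro sum_mono) auto
    then show "norm z \<le> 4" using L2_set_le_sum[of UNIV "\<lambda>i. cmod (z $ i)"] by (simp add: norm_vec_def)
  qed
  ultimately have "compactin (top_of_set U) K" using KU by (simp add: compactin_subtopology compact_eq_bounded_closed)
  then have "compactin (mtop X) (orbit ` K)" using image_compactin continuous_map_orbit by blast
  moreover have "orbit ` K = orbit ` U"
  proof
    show "orbit ` K \<subseteq> orbit ` U" using KU by blast
    show "orbit ` U \<subseteq> orbit ` K"
    proof
      fix A assume "A \<in> orbit ` U"
      then obtain z where z: "z \<in> U" "A = orbit z" by blast
      \<comment> \<open>Subtracting the floors moves both logarithmic coordinates into the unit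
        interval.\<close>
      define w where "w = deck (- \<lfloor>L1 z\<rfloor>) (- \<lfloor>L2 z\<rfloor>) z"
      have w: "w \<in> U" using z by (simp add: w_def)
      have "0 \<le> L1 w" "L1 w \<le> 1" "0 \<le> L2 w" "L2 w \<le> 1"
        using z(1) by (simp_all add: w_def L1_deck L2_deck) linarith+
      then have "- (4 * pi) \<le> ln (R2 w)" "ln (R2 w) \<le> 0" "- (4 * pi) \<le> ln (S2 w)" "ln (S2 w) \<le> 0"
        by (simp_all add: L1_def L2_def field_simps)
      then have "w \<in> K"
        using R2_pos[OF w] S2_pos[OF w] by (simp add: K_iff \<rho>_def exp_le_cancel_iff ln_ge_iff)
      moreover have "A = orbit w" by (simp add: w_def z)
      ultimately show "A \<in> orbit ` K" by blast
    qed
  qed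
  ultimately show ?thesis by (simp add: compact_space_def topspace_X)
qed

section \<open>Holomorphic functions of several variables\<close>

text \<open>The scalar counterpart of \<open>holo_on\<close>, with a homogeneous derivative in place
  of a matrix so that the rules for sums, products and quotients apply directly.\<close>

definition holo_at :: "(complex^'n \<Rightarrow> complex) \<Rightarrow> complex^'n \<Rightarrow> bool" where
  "holo_at f z \<longleftrightarrow> (\<exists>L. (f has_derivative L) (at z) \<and> (\<forall>c h. L (c *s h) = c * L h))"

lemma holo_at_const [intro]: "holo_at (\<lambda>w. c) z"
  unfolding holo_at_def by (intro exI[of _ "\<lambda>h. 0"]) auto

lemma holo_at_nth [intro]: "holo_at (\<lambda>w. w $ i) z"
  unfolding holo_at_def
  by (intro exI[of _ "\<lambda>h. h $ i"]) (auto intro!: bounded_linear_imp_has_derivative bounded_linear_vec_nth)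

lemma holo_at_minus [intro]:
  assumes "holo_at f z" shows "holo_at (\<lambda>w. - f w) z"
proof -
  from assms obtain L where "(f has_derivative L) (at z)" "\<forall>c h. L (c *s h) = c * L h"
    unfolding holo_at_def by blast
  then show ?thesis
    unfolding holo_at_def by (intro exI[of _ "\<lambda>h. - L h"]) (auto intro!: has_derivative_minus)
qed

lemma holo_at_add [intro]:
  assumes "holo_at f z" "holo_at g z" shows "holo_at (\<lambda>w. f w + g w) z"
proof -
  from assms obtain L M where
    "(f has_derivative L) (at z)" "\<forall>c h. L (c *s h) = c * L h"
    "(g has_derivative M) (at z)" "\<forall>c h. M (c *s h) = c * M h"
    unfolding holo_at_def by blast
  then show ?thesis
    unfolding holo_at_def
    by (intro exI[of _ "\<lambda>h. L h + M h"]) (auto intro!: has_derivative_add simp: distrib_left)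
qed

lemma holo_at_mult [intro]:
  assumes "holo_at f z" "holo_at g z" shows "holo_at (\<lambda>w. f w * g w) z"
proof -
  from assms obtain L M where
    "(f has_derivative L) (at z)" "\<forall>c h. L (c *s h) = c * L h"
    "(g has_derivative M) (at z)" "\<forall>c h. M (c *s h) = c * M h"
    unfolding holo_at_def by blast
  then show ?thesis
    unfolding holo_at_def
    by (intro exI[of _ "\<lambda>h. f z * M h + L h * g z"]) (intro conjI has_derivative_mult; simp add: algebra_simps)
qed

lemma holo_at_divide [intro]:
  assumes "holo_at f z" "holo_at g z" "g z \<noteq> 0" shows "holo_at (\<lambda>w. f w / g w) z"
proof -
  from assms obtain L M where
    "(f has_derivative L) (at z)" "\<forall>c h. L (c *s h) = c * L h"
    "(g has_derivative M) (at z)" "\<forall>c h. M (c *s h) = c * M h"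
    unfolding holo_at_def by blast
  then show ?thesis
    unfolding holo_at_def using assms(3)
    by (intro exI[of _ "\<lambda>h. (L h * g z - f z * M h) / (g z * g z)"])
       (intro conjI has_derivative_divide'; simp add: algebra_simps diff_divide_distrib)
qed

lemma holo_at_cong:
  assumes "holo_at g z" "\<forall>\<^sub>F w in nhds z. f w = g w"
  shows "holo_at f z"
proof -
  from assms(2) obtain S where "open S" "z \<in> S" "\<And>w. w \<in> S \<Longrightarrow> g w = f w"
    unfolding eventually_nhds by metis
  then show ?thesis
    using assms(1) unfolding holo_at_def by (meson has_derivative_transform_within_open)
qed

lemma has_derivative_vecI:
  fixes f :: "'a::real_normed_vector \<Rightarrow> 'b::euclidean_space^'m"
  assumes "\<And>i. ((\<lambda>z. f z $ i) has_derivative (\<lambda>h. f' h $ i)) (at z)"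
  shows "(f has_derivative f') (at z)"
  unfolding has_derivative_componentwise_within[of f]
  using assms by (auto simp: Basis_vec_def inner_axis intro!: has_derivative_inner_left)

text \<open>A real-linear map that commutes with complex scalars is given by a complex matrix, whose
  entries are its values on the axis vectors.\<close>

lemma holo_at_vec:
  fixes f :: "complex^'n \<Rightarrow> complex^'m"
  shows "(\<forall>i. holo_at (\<lambda>w. f w $ i) z) \<longleftrightarrow> (\<exists>A. (f has_derivative (\<lambda>h. A *v h)) (at z))"
proof
  assume "\<forall>i. holo_at (\<lambda>w. f w $ i) z"
  then obtain L where L: "\<And>i. ((\<lambda>w. f w $ i) has_derivative L i) (at z)" "\<And>i c h. L i (c *s h) = c * L i h"
    unfolding holo_at_def by metis
  define A where "A = (\<chi> i j. L i (axis j 1))"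
  have "L i h = (A *v h) $ i" for i h
  proof -
    have lin: "linear (L i)" using L(1) has_derivative_linear by blast
    have "h = (\<Sum>j\<in>UNIV. h $ j *s axis j 1)" by (simp add: basis_expansion)
    then have "L i h = (\<Sum>j\<in>UNIV. L i (h $ j *s axis j 1))" by (metis lin linear_sum)
    also have "\<dots> = (A *v h) $ i" by (simp add: A_def matrix_vector_mult_def L(2) mult.commute)
    finally show ?thesis .
  qed
  then have "((\<lambda>w. f w $ i) has_derivative (\<lambda>h. (A *v h) $ i)) (at z)" for i
    using L(1)[of i] by (metis (no_types, lifting) ext)
  then show "\<exists>A. (f has_derivative (\<lambda>h. A *v h)) (at z)" by (auto intro!: has_derivative_vecI)
next
  assume "\<exists>A. (f has_derivative (\<lambda>h. A *v h)) (at z)"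
  then obtain A where A: "(f has_derivative (\<lambda>h. A *v h)) (at z)" by blast
  have "((\<lambda>w. f w $ i) has_derivative (\<lambda>h. (A *v h) $ i)) (at z)" for i
    using bounded_linear.has_derivative[OF bounded_linear_vec_nth A] .
  moreover have "(A *v (c *s h)) $ i = c * (A *v h) $ i" for i c h
    by (simp add: vector_scalar_commute)
  ultimately show "\<forall>i. holo_at (\<lambda>w. f w $ i) z"
    unfolding holo_at_def by blast
qed

lemma holo_on_iff: "holo_on f S \<longleftrightarrow> (\<forall>z\<in>S. \<forall>i. holo_at (\<lambda>w. f w $ i) z)"
  unfolding holo_on_def holo_at_vec[symmetric] by blast

text \<open>Chart expressions contain inverses of injections and agree only locally with explicit
  formulas; the formula may change from point to point, for instance with the deck
  transformation.\<close>

lemma holo_onI: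
  assumes "\<And>z. z \<in> S \<Longrightarrow> \<exists>g. (\<forall>\<^sub>F w in nhds z. f w = g w) \<and> (\<forall>i. holo_at (\<lambda>w. g w $ i) z)"
  shows "holo_on f S"
  unfolding holo_on_iff
proof (intro ballI allI)
  fix z i assume "z \<in> S"
  then obtain g where g: "\<forall>\<^sub>F w in nhds z. f w = g w" "\<forall>i. holo_at (\<lambda>w. g w $ i) z" using assms by blast
  show "holo_at (\<lambda>w. f w $ i) z"
  proof (rule holo_at_cong)
    show "holo_at (\<lambda>w. g w $ i) z" using g(2) by blast
    show "\<forall>\<^sub>F w in nhds z. f w $ i = g w $ i" using g(1) by eventually_elim simp
  qed
qed

lemma has_derivative_eventually:
  assumes "(g has_derivative g') (at z)" "\<forall>\<^sub>F w in nhds z. f w = g w"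
  shows "(f has_derivative g') (at z)"
proof -
  from assms(2) obtain S where "open S" "z \<in> S" "\<And>w. w \<in> S \<Longrightarrow> g w = f w"
    unfolding eventually_nhds by metis
  then show ?thesis using assms(1) by (meson has_derivative_transform_within_open)
qed

lemma frechet_derivative_eqI: "(f has_derivative f') (at z) \<Longrightarrow> frechet_derivative f (at z) = f'"
  using frechet_derivative_at by metis


section \<open>Tangent spaces\<close>

lemma chart_open: "complex_manifold M \<Longrightarrow> c \<in> atlas M \<Longrightarrow> openin (mtop M) (fst c)"
  by (auto simp: complex_manifold_def)

lemma chart_open_image:
  assumes "complex_manifold M" "c \<in> atlas M" "openin (mtop M) Q" "Q \<subseteq> fst c"
  shows "open (snd c ` Q)"
proof -
  have h: "homeomorphic_map (subtopology (mtop M) (fst c)) (top_of_set (snd c ` fst c)) (snd c)"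
    and o: "open (snd c ` fst c)"
    using assms by (auto simp: complex_manifold_def)
  have "openin (subtopology (mtop M) (fst c)) Q"
    using assms openin_subtopology by (metis inf.orderE)
  then have "openin (top_of_set (snd c ` fst c)) (snd c ` Q)"
    using homeomorphic_imp_open_map[OF h] by (simp add: open_map_def)
  then show ?thesis using o openin_open_eq by blast
qed

lemma chart_inv_snd:
  assumes "complex_manifold M" "c \<in> atlas M" "x \<in> fst c"
  shows "chart_inv c (snd c x) = x"
proof -
  have h: "homeomorphic_map (subtopology (mtop M) (fst c)) (top_of_set (snd c ` fst c)) (snd c)"
    and "fst c \<subseteq> topspace (mtop M)"
    using assms openin_subset by (auto simp: complex_manifold_def)
  then have "inj_on (snd c) (fst c)"
    using homeomorphic_imp_injective_map[OF h] by (simp add: Int_absorb1)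
  then show ?thesis using assms(3) by (simp add: chart_inv_def the_inv_into_f_f)
qed

lemma charts_at_nonempty:
  "complex_manifold M \<Longrightarrow> x \<in> topspace (mtop M) \<Longrightarrow> charts_at M x \<noteq> {}"
  unfolding complex_manifold_def charts_at_def by blast

lemma eventually_chart:
  assumes "complex_manifold M" "c \<in> charts_at M x" "d \<in> charts_at M x"
  shows "\<forall>\<^sub>F w in nhds (snd c x). chart_inv c w \<in> fst c \<inter> fst d \<and> snd c (chart_inv c w) = w"
proof -
  have cd: "c \<in> atlas M" "d \<in> atlas M" "x \<in> fst c \<inter> fst d" using assms by (auto simp: charts_at_def)
  have "open (snd c ` (fst c \<inter> fst d))"
    using assms cd by (intro chart_open_image) (auto intro: chart_open)
  moreover have "chart_inv c w \<in> fst c \<inter> fst d \<and> snd c (chart_inv c w) = w" if "w \<in> snd c ` (fst c \<inter> fst d)" for w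
    using that chart_inv_snd[OF assms(1) cd(1)] by auto
  ultimately show ?thesis unfolding eventually_nhds using cd by blast
qed

definition transition :: "('a, 'n::finite) cmanifold \<Rightarrow> 'a \<Rightarrow> ('a, 'n) chart \<Rightarrow> ('a, 'n) chart \<Rightarrow> complex^'n \<Rightarrow> complex^'n" where
  "transition M x c d = frechet_derivative (snd d \<circ> chart_inv c) (at (snd c x))"

lemma transition_derivative:
  assumes "complex_manifold M" "c \<in> charts_at M x" "d \<in> charts_at M x"
  shows "((snd d \<circ> chart_inv c) has_derivative transition M x c d) (at (snd c x))"
proof -
  have "holo_on (snd d \<circ> chart_inv c) (snd c ` (fst c \<inter> fst d))" "x \<in> fst c \<inter> fst d"
    using assms by (auto simp: complex_manifold_def charts_at_def)
  then have "(snd d \<circ> chart_inv c) differentiable (at (snd c x))"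
    unfolding holo_on_def differentiable_def by blast
  then show ?thesis unfolding transition_def by (simp add: frechet_derivative_works)
qed

lemma linear_transition:
  assumes "complex_manifold M" "c \<in> charts_at M x" "d \<in> charts_at M x"
  shows "linear (transition M x c d)"
  using transition_derivative[OF assms] has_derivative_linear by blast

lemma transition_self:
  assumes "complex_manifold M" "c \<in> charts_at M x"
  shows "transition M x c c = id"
  unfolding transition_def
proof (rule frechet_derivative_eqI, rule has_derivative_eventually)
  show "(id has_derivative id) (at (snd c x))" by (simp add: id_def)
  show "\<forall>\<^sub>F w in nhds (snd c x). (snd c \<circ> chart_inv c) w = id w"
    using eventually_chart[OF assms assms(2)] by eventually_elim simp
qed

text \<open>The chain rule for \<open>e \<circ> c^(-1) = (e \<circ> d^(-1)) \<circ> (d \<circ>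
  c^(-1))\<close>, valid near the point. It is what makes a coordinate vector in one chart extend to
  a compatible family.\<close>

lemma transition_trans:
  assumes "complex_manifold M" "c \<in> charts_at M x" "d \<in> charts_at M x" "e \<in> charts_at M x"
  shows "transition M x d e (transition M x c d v) = transition M x c e v"
proof -
  have cd: "c \<in> atlas M" "d \<in> atlas M" "x \<in> fst c \<inter> fst d" using assms by (auto simp: charts_at_def)
  have x: "(snd d \<circ> chart_inv c) (snd c x) = snd d x"
    using cd chart_inv_snd[OF assms(1)] by auto
  have "((snd e \<circ> chart_inv d) \<circ> (snd d \<circ> chart_inv c) has_derivative
      transition M x d e \<circ> transition M x c d) (at (snd c x))"
    by (intro diff_chain_at transition_derivative assms, unfold x, intro transition_derivative assms)
  moreover have "\<forall>\<^sub>F w in nhds (snd c x). (snd e \<circ> chart_inv c) w = ((snd e \<circ> chart_inv d) \<circ> (snd d \<circ> chart_inv c)) w"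
    using eventually_chart[OF assms(1-3)]
    by eventually_elim (simp add: chart_inv_snd[OF assms(1) cd(2)])
  ultimately have "((snd e \<circ> chart_inv c) has_derivative transition M x d e \<circ> transition M x c d) (at (snd c x))"
    by (rule has_derivative_eventually)
  then have "transition M x c e = transition M x d e \<circ> transition M x c d"
    unfolding transition_def[of M x c e] by (rule frechet_derivative_eqI)
  then show ?thesis by simp
qed

lemma tangent_space_iff:
  "t \<in> tangent_space M x \<longleftrightarrow> (\<forall>c. c \<notin> charts_at M x \<longrightarrow> t c = 0) \<and>
     (\<forall>c\<in>charts_at M x. \<forall>d\<in>charts_at M x. t d = transition M x c d (t c))"
  by (simp add: tangent_space_def transition_def)

definition tangent_of :: "('a, 'n::finite) cmanifold \<Rightarrow> 'a \<Rightarrow> ('a, 'n) chart \<Rightarrow> complex^'n \<Rightarrow> ('a, 'n) tangent" where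
  "tangent_of M x c v = (\<lambda>d. if d \<in> charts_at M x then transition M x c d v else 0)"

lemma tangent_of_in:
  "complex_manifold M \<Longrightarrow> c \<in> charts_at M x \<Longrightarrow> tangent_of M x c v \<in> tangent_space M x"
  unfolding tangent_space_iff by (simp add: tangent_of_def transition_trans)

lemma tangent_of_self:
  "complex_manifold M \<Longrightarrow> c \<in> charts_at M x \<Longrightarrow> tangent_of M x c v c = v"
  by (simp add: tangent_of_def transition_self)

text \<open>The transition maps determine a tangent vector from any one component, so later
  identities are computed in a single convenient chart.\<close>

lemma tangent_eqI:
  assumes "t \<in> tangent_space M x" "t' \<in> tangent_space M x" "c \<in> charts_at M x" "t c = t' c"
  shows "t = t'"
  using assms unfolding tangent_space_iff by (metis ext)

lemma tangent_space_add:
  assumes "complex_manifold M" "t \<in> tangent_space M x" "t' \<in> tangent_space M x"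
  shows "t + t' \<in> tangent_space M x"
  unfolding tangent_space_iff
proof (intro conjI allI ballI impI)
  fix c d assume c: "c \<in> charts_at M x" and d: "d \<in> charts_at M x"
  then have "t d = transition M x c d (t c)" "t' d = transition M x c d (t' c)"
    using assms(2,3) unfolding tangent_space_iff by blast+
  then show "(t + t') d = transition M x c d ((t + t') c)"
    by (simp add: linear_add[OF linear_transition[OF assms(1) c d]])
next
  fix c assume "c \<notin> charts_at M x"
  then have "t c = 0" "t' c = 0" using assms(2,3) unfolding tangent_space_iff by blast+
  then show "(t + t') c = 0" by simp
qed

lemma tangent_space_diff:
  assumes "complex_manifold M" "t \<in> tangent_space M x" "t' \<in> tangent_space M x"
  shows "t - t' \<in> tangent_space M x"
  unfolding tangent_space_iff
proof (intro conjI allI ballI impI)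
  fix c d assume c: "c \<in> charts_at M x" and d: "d \<in> charts_at M x"
  then have "t d = transition M x c d (t c)" "t' d = transition M x c d (t' c)"
    using assms(2,3) unfolding tangent_space_iff by blast+
  then show "(t - t') d = transition M x c d ((t - t') c)"
    by (simp add: linear_diff[OF linear_transition[OF assms(1) c d]])
next
  fix c assume "c \<notin> charts_at M x"
  then have "t c = 0" "t' c = 0" using assms(2,3) unfolding tangent_space_iff by blast+
  then show "(t - t') c = 0" by simp
qed

lemma eventually_continuous_map:
  assumes "continuous_map (top_of_set S) T F" "open S" "z \<in> S" "openin T Q" "F z \<in> Q"
  shows "\<forall>\<^sub>F w in nhds z. w \<in> S \<and> F w \<in> Q"
proof -
  have "openin (top_of_set S) {w \<in> topspace (top_of_set S). F w \<in> Q}"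
    using assms openin_continuous_map_preimage by blast
  then have "open {w \<in> S. F w \<in> Q}" using assms(2) openin_open_eq by auto
  then show ?thesis unfolding eventually_nhds using assms by (intro exI[of _ "{w \<in> S. F w \<in> Q}"]) auto
qed

text \<open>\<open>dmap\<close> differentiates in each target chart separately; the chain rule shows
  that the results are compatible.\<close>

lemma dmap_in_tangent_space:
  assumes M: "complex_manifold M" and F: "continuous_map (top_of_set S) (mtop M) F" "open S" "z \<in> S"
    and diff: "\<And>d. d \<in> charts_at M (F z) \<Longrightarrow> (snd d \<circ> F) differentiable (at z)"
  shows "dmap M F z v \<in> tangent_space M (F z)"
  unfolding tangent_space_iff
proof (intro conjI allI ballI impI)
  fix c d assume c: "c \<in> charts_at M (F z)" and d: "d \<in> charts_at M (F z)"
  then have cd: "c \<in> atlas M" "d \<in> atlas M" "F z \<in> fst c" by (auto simp: charts_at_def)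
  have "((snd d \<circ> chart_inv c) \<circ> (snd c \<circ> F) has_derivative
     transition M (F z) c d \<circ> frechet_derivative (snd c \<circ> F) (at z)) (at z)"
    by (rule diff_chain_at) (use transition_derivative[OF M c d] diff[OF c] in \<open>auto simp: frechet_derivative_works\<close>)
  moreover have "\<forall>\<^sub>F w in nhds z. (snd d \<circ> F) w = ((snd d \<circ> chart_inv c) \<circ> (snd c \<circ> F)) w"
    using eventually_continuous_map[OF F chart_open[OF M cd(1)] cd(3)]
    by eventually_elim (simp add: chart_inv_snd[OF M cd(1)])
  ultimately have "((snd d \<circ> F) has_derivative
     transition M (F z) c d \<circ> frechet_derivative (snd c \<circ> F) (at z)) (at z)"
    by (rule has_derivative_eventually)
  then show "dmap M F z v d = transition M (F z) c d (dmap M F z v c)"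
    using c d by (simp add: dmap_def frechet_derivative_eqI)
qed (simp add: dmap_def)


section \<open>\<open>X\<close> as a complex manifold\<close>

text \<open>Charts are known through their composites with the projection. As the projection is a
  homeomorphism on a sheet, the chart inherits this property from the composite.\<close>

lemma homeomorphic_map_factor:
  assumes "homeomorphic_map A B f" "homeomorphic_map A C h" "\<And>x. x \<in> topspace A \<Longrightarrow> g (f x) = h x"
  shows "homeomorphic_map B C g"
proof -
  obtain f' where f': "homeomorphic_maps A B f f'" using assms(1) homeomorphic_map_maps by blast
  then have "homeomorphic_map B A f'" using homeomorphic_maps_map by blast
  then have "homeomorphic_map B C (h \<circ> f')" using assms(2) homeomorphic_map_compose by blast
  moreover have "(h \<circ> f') y = g y" if "y \<in> topspace B" for y
  proof -
    have "f' y \<in> topspace A" "f (f' y) = y"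
      using f' that by (auto simp: homeomorphic_maps_def continuous_map_def)
    then show ?thesis using assms(3)[of "f' y"] by simp
  qed
  ultimately show ?thesis using homeomorphic_map_eq by blast
qed

lemma open_map_imp_homeomorphic_onto_image:
  assumes "continuous_map A B f" "open_map A B f" "inj_on f S" "openin A S"
  shows "homeomorphic_map (subtopology A S) (subtopology B (f ` S)) f"
proof (rule bijective_open_imp_homeomorphic_map)
  have S: "S \<subseteq> topspace A" using assms(4) openin_subset by blast
  have fS: "openin B (f ` S)" using assms by (simp add: open_map_def)
  show "continuous_map (subtopology A S) (subtopology B (f ` S)) f"
    using assms(1) by (auto simp: continuous_map_in_subtopology continuous_map_from_subtopology)
  show "open_map (subtopology A S) (subtopology B (f ` S)) f"
    unfolding open_map_def
  proof (intro allI impI)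
    fix Q assume "openin (subtopology A S) Q"
    then have "openin A Q" "Q \<subseteq> S" using assms(4) openin_open_subtopology by blast+
    then show "openin (subtopology B (f ` S)) (f ` Q)"
      using assms(2) fS by (simp add: open_map_def openin_open_subtopology image_mono)
  qed
  show "f ` topspace (subtopology A S) = topspace (subtopology B (f ` S))"
    using S openin_subset[OF fS] by (auto simp: topspace_subtopology)
  show "inj_on f (topspace (subtopology A S))"
    using S assms(3) by (simp add: Int_absorb1)
qed

definition chartX :: "(complex^4) set \<Rightarrow> ((complex^4) set, 4) chart" where
  "chartX V = (orbit ` V, the_inv_into V orbit)"

definition sheet :: "(complex^4) set \<Rightarrow> bool" where
  "sheet V \<longleftrightarrow> open V \<and> V \<subseteq> U \<and> inj_on orbit V"

lemma atlas_X: "atlas X = {chartX V | V. sheet V}"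
  by (simp add: X_def chartX_def sheet_def)

lemma local_branch: "sheet V \<Longrightarrow> z \<in> V \<Longrightarrow> the_inv_into V orbit (orbit z) = z"
  by (simp add: sheet_def the_inv_into_f_f)

lemma chartX_inv: "sheet V \<Longrightarrow> z \<in> V \<Longrightarrow> chart_inv (chartX V) z = orbit z"
  unfolding chart_inv_def chartX_def
  by (simp add: sheet_def the_inv_into_f_eq inj_on_the_inv_into the_inv_into_f_f)

lemma chartX_image: "sheet V \<Longrightarrow> snd (chartX V) ` fst (chartX V) = V"
  by (simp add: chartX_def sheet_def)

lemma eventually_deck:
  assumes "open V" "deck a b z \<in> V" shows "\<forall>\<^sub>F w in nhds z. deck a b w \<in> V"
proof -
  have "open (deck a b -` V)"
    using assms(1) continuous_on_deck[OF continuous_on_id] by (rule open_vimage)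
  then show ?thesis unfolding eventually_nhds using assms(2) by blast
qed

lemma holo_at_deck: "holo_at (\<lambda>w. deck a b w $ i) z"
  using exhaust_4[of i] by (auto simp: holo_at_nth holo_at_const holo_at_mult)

text \<open>Near each point a transition map coincides with one deck transformation, because
  membership of the translate in the target sheet is an open condition.\<close>

lemma complex_manifold_X: "complex_manifold X"
  unfolding complex_manifold_def
proof (intro conjI ballI)
  show "Hausdorff_space (mtop X)" by (rule Hausdorff_X)
  show "second_countable (mtop X)" by (rule second_countable_X)
  show "(\<Union>c\<in>atlas X. fst c) = topspace (mtop X)"
    unfolding topspace_X
  proof
    show "(\<Union>c\<in>atlas X. fst c) \<subseteq> orbit ` U" by (auto simp: atlas_X chartX_def sheet_def) blast
    show "orbit ` U \<subseteq> (\<Union>c\<in>atlas X. fst c)"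
    proof
      fix A assume "A \<in> orbit ` U"
      then obtain z V where "A = orbit z" "sheet V" "z \<in> V"
        using orbit_locally_inj unfolding sheet_def by (metis imageE)
      then show "A \<in> (\<Union>c\<in>atlas X. fst c)" unfolding atlas_X by (auto simp: chartX_def)
    qed
  qed
next
  fix c assume "c \<in> atlas X"
  then obtain V where V: "sheet V" and c: "c = chartX V" by (auto simp: atlas_X)
  have o: "openin (top_of_set U) V" using V by (simp add: sheet_def openin_open_eq open_U)
  show "openin (mtop X) (fst c)" using V by (simp add: c chartX_def sheet_def openin_orbit_image)
  show "open (snd c ` fst c)" using V by (simp add: c chartX_image) (simp add: sheet_def)
  have "homeomorphic_map (subtopology (top_of_set U) V) (subtopology (mtop X) (orbit ` V)) orbit"
    using V o by (intro open_map_imp_homeomorphic_onto_image continuous_map_orbit open_map_orbit) (auto simp: sheet_def)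
  moreover have "subtopology (top_of_set U) V = top_of_set V"
    using V by (simp add: sheet_def subtopology_subtopology Int_absorb1)
  ultimately have "homeomorphic_map (top_of_set V) (subtopology (mtop X) (orbit ` V)) orbit" by simp
  then have "homeomorphic_map (subtopology (mtop X) (orbit ` V)) (top_of_set V) (the_inv_into V orbit)"
    by (rule homeomorphic_map_factor[where h = id]) (auto simp: local_branch V homeomorphic_map_id)
  then show "homeomorphic_map (subtopology (mtop X) (fst c)) (top_of_set (snd c ` fst c)) (snd c)"
    unfolding c chartX_image[OF V] by (simp add: chartX_def)
next
  fix c d assume "c \<in> atlas X" "d \<in> atlas X"
  then obtain V V' where V: "sheet V" "sheet V'" and c: "c = chartX V" and d: "d = chartX V'"
    by (auto simp: atlas_X)
  show "holo_on (snd d \<circ> chart_inv c) (snd c ` (fst c \<inter> fst d))"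
  proof (rule holo_onI)
    fix z assume "z \<in> snd c ` (fst c \<inter> fst d)"
    then obtain w where w: "w \<in> V" "orbit w \<in> orbit ` V'" "z = the_inv_into V orbit (orbit w)"
      unfolding c d by (auto simp: chartX_def)
    then have z: "z \<in> V" "orbit z \<in> orbit ` V'" using V by (auto simp: local_branch)
    then obtain a b where ab: "deck a b z \<in> V'" using orbit_eq_iff by (metis imageE)
    have "\<forall>\<^sub>F w in nhds z. w \<in> V" using V z by (auto simp: sheet_def eventually_nhds)
    moreover have "\<forall>\<^sub>F w in nhds z. deck a b w \<in> V'" using V ab by (auto simp: sheet_def intro: eventually_deck)
    ultimately have "\<forall>\<^sub>F w in nhds z. (snd d \<circ> chart_inv c) w = deck a b w"
    proof eventually_elim
      case (elim w)
      then show ?case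
        using local_branch[OF V(2), of "deck a b w"] by (simp add: c d chartX_inv V) (simp add: chartX_def)
    qed
    then show "\<exists>g. (\<forall>\<^sub>F w in nhds z. (snd d \<circ> chart_inv c) w = g w) \<and> (\<forall>i. holo_at (\<lambda>w. g w $ i) z)"
      using holo_at_deck by blast
  qed
qed

section \<open>The total space\<close>

abbreviation unit_disk :: "complex set" where
  "unit_disk \<equiv> ball 0 1"

definition embed5 :: "complex^4 \<Rightarrow> complex \<Rightarrow> complex^5" where
  "embed5 z s = vector [z$1, z$2, z$3, z$4, s]"

lemma embed5_nth [simp]: "embed5 z s $ 1 = z$1" "embed5 z s $ 2 = z$2" "embed5 z s $ 3 = z$3" "embed5 z s $ 4 = z$4" "embed5 z s $ 5 = s"
  by (simp_all add: embed5_def)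

definition deck5 :: "int \<Rightarrow> int \<Rightarrow> complex^5 \<Rightarrow> complex^5" where
  "deck5 a b w = vector [q_pow a * w$1, q_pow b * w$2, q_pow a * w$3, q_pow (2 * a + b) * w$4, w$5]"

lemma deck5_nth [simp]:
  "deck5 a b w $ 1 = q_pow a * w$1" "deck5 a b w $ 2 = q_pow b * w$2"
  "deck5 a b w $ 3 = q_pow a * w$3" "deck5 a b w $ 4 = q_pow (2 * a + b) * w$4" "deck5 a b w $ 5 = w$5"
  by (simp_all add: deck5_def)

section \<open>Twisted coordinates on the product\<close>

text \<open>\<open>True\<close> stands for \<open>x \<noteq> 0\<close> and \<open>False\<close> for
  \<open>y \<noteq> 0\<close>; each half contains two of the four Cech charts.\<close>

definition branch_dom :: "bool \<Rightarrow> (complex^4) set" where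
  "branch_dom k = {z \<in> U. (if k then z$1 else z$3) \<noteq> 0}"

text \<open>The two functions are smooth, and \<open>splitting True - splitting False = - v / (x y)\<close>: a splitting of the
  class of \<open>1 / (x y)\<close> in \<open>H\<^sup>1(\<complex>\<^sup>2 - 0, \<O>)\<close> by smooth functions. So the deformation is
  topologically the product with the disk.\<close>

definition splitting :: "bool \<Rightarrow> complex^4 \<Rightarrow> complex" where
  "splitting k z = (if k then - (z$4 * cnj (z$3)) / (z$1 * of_real (R2 z))
             else z$4 * cnj (z$1) / (z$3 * of_real (R2 z)))"

text \<open>These are the coordinates to be declared holomorphic. They are not holomorphic for the
  product structure, since \<open>splitting\<close> involves conjugates and \<open>R2\<close>; the
  parameter \<open>s\<close> is kept as fifth entry.\<close>

definition coord :: "bool \<Rightarrow> (complex^4) \<times> complex \<Rightarrow> complex^5" where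
  "coord k = (\<lambda>(z, s). vector [z$1, z$2 + s * splitting k z, z$3, z$4, s])"

lemma coord_nth [simp]: "coord k (z, s) $ 1 = z$1" "coord k (z, s) $ 2 = z$2 + s * splitting k z"
  "coord k (z, s) $ 3 = z$3" "coord k (z, s) $ 4 = z$4" "coord k (z, s) $ 5 = s"
  by (simp_all add: coord_def)

definition restrict4 :: "complex^5 \<Rightarrow> complex^4" where
  "restrict4 w = vector [w$1, w$2, w$3, w$4]"

lemma restrict4_nth [simp]: "restrict4 w $ 1 = w$1" "restrict4 w $ 2 = w$2" "restrict4 w $ 3 = w$3" "restrict4 w $ 4 = w$4"
  by (simp_all add: restrict4_def)

definition coord_inv :: "bool \<Rightarrow> complex^5 \<Rightarrow> (complex^4) \<times> complex" where
  "coord_inv k w = (vector [w$1, w$2 - w$5 * splitting k (restrict4 w), w$3, w$4], w$5)"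

text \<open>The coordinate change \<open>u \<mapsto> u \<mp> s v / (x y)\<close>, the flow of \<open>\<mp>W\<close>.\<close>

definition shift :: "bool \<Rightarrow> bool \<Rightarrow> complex^5 \<Rightarrow> complex" where
  "shift k k' w = (if k = k' then 0 else if k' then - (w$4 / (w$1 * w$3)) else w$4 / (w$1 * w$3))"

definition shear :: "bool \<Rightarrow> bool \<Rightarrow> complex^5 \<Rightarrow> complex^5" where
  "shear k k' w = vector [w$1, w$2 + w$5 * shift k k' w, w$3, w$4, w$5]"

lemma shear_nth [simp]: "shear k k' w $ 1 = w$1" "shear k k' w $ 2 = w$2 + w$5 * shift k k' w"
  "shear k k' w $ 3 = w$3" "shear k k' w $ 4 = w$4" "shear k k' w $ 5 = w$5"
  by (simp_all add: shear_def)

lemma restrict4_embed5 [simp]: "restrict4 (embed5 z s) = z"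
  by (simp add: vec4_eq_iff)

text \<open>The function ignores \<open>u\<close>, the only coordinate that the twist changes, so
  subtracting the same value undoes the twist.\<close>

lemma splitting_cong: "z$1 = w$1 \<Longrightarrow> z$3 = w$3 \<Longrightarrow> z$4 = w$4 \<Longrightarrow> splitting k z = splitting k w"
  by (simp add: splitting_def R2_def)

lemma coord_inv_coord [simp]: "coord_inv k (coord k p) = p"
proof (cases p)
  case (Pair z s)
  have "splitting k (restrict4 (coord k (z, s))) = splitting k z" by (rule splitting_cong) auto
  then show ?thesis by (simp add: Pair coord_inv_def vec4_eq_iff)
qed

lemma coord_coord_inv [simp]: "coord k (coord_inv k w) = w"
proof -
  have "splitting k (vector [w$1, w$2 - w$5 * splitting k (restrict4 w), w$3, w$4]) = splitting k (restrict4 w)" by (rule splitting_cong) auto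
  then show ?thesis by (simp add: coord_inv_def vec5_eq_iff)
qed

lemma coord_0 [simp]: "coord k (z, 0) = embed5 z 0"
  by (simp add: vec5_eq_iff)

text \<open>As \<open>q0\<close> is real, conjugates have the same weights. The exponent of
  \<open>g_1\<close> is \<open>2 + 1 - 1 - 2 = 0\<close>, from \<open>v\<close>, the conjugate, the
  denominator and \<open>R2\<close>; only the weight of \<open>v\<close> under \<open>g_2\<close>
  survives, which is that of \<open>u\<close>.\<close>

lemma splitting_deck: "splitting k (deck a b z) = q_pow b * splitting k z"
proof -
  have r: "complex_of_real (exp (- (4 * pi * of_int a))) = q_pow a * q_pow a"
    unfolding q_pow_add[symmetric] by (simp add: q_pow_def)
  have q4: "q_pow (2 * a + b) = q_pow a * q_pow a * q_pow b"
    by (simp add: q_pow_add[symmetric])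
  show ?thesis by (simp add: splitting_def R2_deck r q4)
qed

lemma coord_deck: "coord k (deck a b z, s) = deck5 a b (coord k (z, s))"
  by (simp add: vec5_eq_iff splitting_deck distrib_left)

text \<open>The splitting comes from the partition of unity \<open>|x|^2/R2 + |y|^2/R2 = 1\<close>:
  multiplied by \<open>1/(xy)\<close>, its two terms extend smoothly over \<open>x = 0\<close> and
  \<open>y = 0\<close> respectively. In the difference of the branches the terms recombine and
  everything non-holomorphic cancels.\<close>

lemma coord_trans:
  assumes "z \<in> branch_dom k" "z \<in> branch_dom k'" shows "coord k' (z, s) = shear k k' (coord k (z, s))"
proof -
  have "splitting True z - splitting False z = - (z$4 / (z$1 * z$3))" if "z$1 \<noteq> 0" "z$3 \<noteq> 0"
  proof -
    define R where "R = complex_of_real (R2 z)"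
    have R: "R = z$1 * cnj (z$1) + z$3 * cnj (z$3)"
      by (simp only: R_def R2_def of_real_add complex_norm_square)
    have "z \<in> U" using assms by (simp add: branch_dom_def)
    then have "R \<noteq> 0" using R2_pos[of z] by (simp add: R_def)
    moreover from this that have "splitting True z - splitting False z = - (z$4 * (z$1 * cnj (z$1) + z$3 * cnj (z$3))) / (z$1 * z$3 * R)"
      by (simp add: splitting_def field_simps flip: R_def)
    ultimately show ?thesis unfolding R[symmetric] by simp
  qed
  then have "splitting k' z = splitting k z + shift k k' (coord k (z, s))"
    using assms by (cases k; cases k') (auto simp: shift_def branch_dom_def algebra_simps)
  then show ?thesis by (simp add: vec5_eq_iff distrib_left)
qed

lemma branch_dom_subset: "branch_dom k \<subseteq> U"
  by (auto simp: branch_dom_def)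

lemma deck_in_branch_dom [simp]: "deck a b z \<in> branch_dom k \<longleftrightarrow> z \<in> branch_dom k"
  by (auto simp: branch_dom_def)

lemma open_branch_dom: "open (branch_dom k)"
proof -
  have eq: "branch_dom k = U \<inter> {z. (if k then z$1 else z$3) \<noteq> 0}" by (auto simp: branch_dom_def)
  have "open {z::complex^4. (if k then z$1 else z$3) \<noteq> 0}"
    by (cases k) (auto intro!: open_Collect_neq continuous_intros)
  then show ?thesis unfolding eq by (rule open_Int[OF open_U])
qed

lemma U_eq_branch_dom: "U = branch_dom False \<union> branch_dom True"
  by (auto simp: branch_dom_def U_def)

lemma continuous_on_splitting:
  assumes "continuous_on S f" "\<And>x. x \<in> S \<Longrightarrow> (if k then f x $ 1 else f x $ 3) \<noteq> 0"
  shows "continuous_on S (\<lambda>x. splitting k (f x))"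
proof -
  have "complex_of_real (R2 (f x)) \<noteq> 0" if "x \<in> S" for x
  proof -
    have "R2 (f x) > 0"
      using assms(2)[OF that] by (auto simp: R2_def add_nonneg_pos add_pos_nonneg split: if_splits)
    then show ?thesis by simp
  qed
  moreover have "continuous_on S (\<lambda>x. R2 (f x))"
    unfolding R2_def by (intro continuous_intros assms)
  ultimately show ?thesis
    using assms(2) unfolding splitting_def by (cases k) (auto intro!: continuous_intros assms(1))
qed

lemma continuous_on_coord: "continuous_on (branch_dom k \<times> UNIV) (coord k)"
  unfolding coord_def case_prod_unfold
  by (intro continuous_intros continuous_on_splitting) (auto simp: branch_dom_def split: if_splits)

text \<open>The image is a preimage under the inverse map, which is continuous on the open subset of
  \<open>C^5\<close> where the coordinate inverted by branch \<open>k\<close> does not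
  vanish.\<close>

lemma open_coord_image:
  assumes "open Q" "Q \<subseteq> branch_dom k \<times> UNIV"
  shows "open (coord k ` Q)"
proof -
  define C where "C = {w::complex^5. (if k then w$1 else w$3) \<noteq> 0}"
  have C: "open C" unfolding C_def by (cases k) (auto intro!: open_Collect_neq continuous_intros)
  have "continuous_on C (coord_inv k)"
    unfolding coord_inv_def restrict4_def by (intro continuous_intros continuous_on_splitting) (auto simp: C_def split: if_splits)
  then have "open (C \<inter> coord_inv k -` Q)" using C assms(1) continuous_open_preimage by blast
  moreover have "coord k ` Q = C \<inter> coord_inv k -` Q"
  proof
    show "coord k ` Q \<subseteq> C \<inter> coord_inv k -` Q" using assms(2) by (auto simp: C_def branch_dom_def split: if_splits)
    show "C \<inter> coord_inv k -` Q \<subseteq> coord k ` Q" by (metis IntE image_eqI coord_coord_inv subsetI vimageD)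
  qed
  ultimately show ?thesis by simp
qed

text \<open>The point \<open>(A, s)\<close> of \<open>X \<times> \<Delta>\<close> becomes the set \<open>A \<times> {s}\<close>; the constant tag \<open>0\<close> carries no
  information.\<close>

definition encode :: "(complex^4) set \<times> complex \<Rightarrow> (nat \<times> (complex^5)) set" where
  "encode = (\<lambda>(A, s). (\<lambda>z. (0, embed5 z s)) ` A)"

abbreviation PT :: "((complex^4) set \<times> complex) set" where
  "PT \<equiv> orbit ` U \<times> unit_disk"

definition decode :: "(nat \<times> (complex^5)) set \<Rightarrow> (complex^4) set \<times> complex" where
  "decode = the_inv_into PT encode"

abbreviation PX :: "((complex^4) set \<times> complex) topology" where
  "PX \<equiv> prod_topology (mtop X) (top_of_set unit_disk)"

text \<open>The product is transported because the points of the total space have to be sets of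
  tagged vectors.\<close>

definition Ytop :: "(nat \<times> (complex^5)) set topology" where
  "Ytop = pullback_topology (encode ` PT) decode PX"

text \<open>Forgetting the last coordinate recovers the orbit; since orbits are nonempty, any point
  recovers the parameter.\<close>

lemma inj_encode: "inj_on encode PT"
proof (rule inj_onI)
  fix p p' assume "p \<in> PT" "p' \<in> PT" and eq: "encode p = encode p'"
  then obtain z s z' s' where p: "p = (orbit z, s)" "p' = (orbit z', s')" by blast
  have encode_fst: "(\<lambda>q. restrict4 (snd q)) ` encode (A, s) = A" for A s
    by (simp add: encode_def image_image)
  have A: "orbit z = orbit z'" using eq p encode_fst by metis
  have "z \<in> orbit z" using orbit_eq deck_0 by (metis (mono_tags, lifting) mem_Collect_eq)
  then have "(0, embed5 z s) \<in> encode p" by (auto simp: p encode_def)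
  then have "(0, embed5 z s) \<in> encode p'" using eq by simp
  then have "s = s'" by (auto simp: p encode_def vec5_eq_iff)
  then show "p = p'" using A p by simp
qed

lemma decode_encode [simp]: "p \<in> PT \<Longrightarrow> decode (encode p) = p"
  by (simp add: decode_def inj_encode the_inv_into_f_f)

lemma topspace_PX [simp]: "topspace PX = PT"
  by (simp add: topspace_X)

lemma homeomorphic_maps_decode: "homeomorphic_maps Ytop PX decode encode"
  unfolding homeomorphic_maps_def
proof (intro conjI ballI)
  have "continuous_map Ytop PX (id \<circ> decode)"
    unfolding Ytop_def by (rule continuous_map_pullback) simp
  then show "continuous_map Ytop PX decode" by simp
  have "continuous_map PX PX (decode \<circ> encode)"
    by (rule continuous_map_eq[of _ _ id]) (auto simp: topspace_X)
  then show "continuous_map PX Ytop encode"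
    unfolding Ytop_def by (rule continuous_map_pullback') (auto simp: topspace_X)
next
  fix y assume "y \<in> topspace Ytop"
  then show "encode (decode y) = y" by (auto simp: Ytop_def topspace_pullback_topology)
qed (simp add: topspace_X)

lemma homeomorphic_map_encode: "homeomorphic_map PX Ytop encode"
  using homeomorphic_maps_decode homeomorphic_maps_map by blast

lemma topspace_Ytop: "topspace Ytop = encode ` PT"
  using homeomorphic_imp_surjective_map[OF homeomorphic_map_encode] by (simp add: topspace_X)

lemma Hausdorff_Ytop: "Hausdorff_space Ytop"
proof -
  have "Hausdorff_space PX"
    by (simp add: Hausdorff_space_prod_topology Hausdorff_X Hausdorff_space_subtopology)
  then show ?thesis
    using homeomorphic_Hausdorff_space homeomorphic_map_encode homeomorphic_map_imp_homeomorphic_space by blast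
qed

definition orbit_pr :: "(complex^4) \<times> complex \<Rightarrow> (nat \<times> (complex^5)) set" where
  "orbit_pr = (\<lambda>(z, s). encode (orbit z, s))"

lemma continuous_map_orbit_pr: "continuous_map (top_of_set (U \<times> unit_disk)) Ytop orbit_pr"
proof -
  have "continuous_map (prod_topology (top_of_set U) (top_of_set unit_disk)) PX (\<lambda>(z, s). (orbit z, s))"
    unfolding continuous_map_prod_top using continuous_map_orbit by simp
  then have "continuous_map (top_of_set (U \<times> unit_disk)) Ytop (encode \<circ> (\<lambda>(z, s). (orbit z, s)))"
    using continuous_map_compose homeomorphic_imp_continuous_map[OF homeomorphic_map_encode] by fastforce
  moreover have "encode \<circ> (\<lambda>(z, s). (orbit z, s)) = orbit_pr" by (auto simp: orbit_pr_def)
  ultimately show ?thesis by simp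
qed

lemma openin_orbit_pr_image:
  assumes "open Q" "Q \<subseteq> U \<times> unit_disk"
  shows "openin Ytop (orbit_pr ` Q)"
proof -
  have "openin PX ((\<lambda>(z, s). (orbit z, s)) ` Q)"
    unfolding openin_prod_topology_alt
  proof (intro allI impI)
    fix A s assume "(A, s) \<in> (\<lambda>(z, s). (orbit z, s)) ` Q"
    then obtain z where z: "A = orbit z" "(z, s) \<in> Q" by auto
    obtain S T where ST: "open S" "open T" "z \<in> S" "s \<in> T" "S \<times> T \<subseteq> Q"
      using open_prod_elim[OF assms(1) z(2)] by (metis mem_Sigma_iff)
    have "S \<subseteq> U" "T \<subseteq> unit_disk" using ST assms(2) by blast+
    then have "openin (mtop X) (orbit ` S)" "openin (top_of_set unit_disk) T"
      using ST by (auto intro: openin_orbit_image simp: openin_open_eq)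
    moreover have "orbit ` S \<times> T \<subseteq> (\<lambda>(z, s). (orbit z, s)) ` Q" using ST(5) by force
    ultimately show "\<exists>S T. openin (mtop X) S \<and> openin (top_of_set unit_disk) T \<and> A \<in> S \<and> s \<in> T \<and>
        S \<times> T \<subseteq> (\<lambda>(z, s). (orbit z, s)) ` Q"
      using z ST by blast
  qed
  then have "openin Ytop (encode ` (\<lambda>(z, s). (orbit z, s)) ` Q)"
    using homeomorphic_imp_open_map[OF homeomorphic_map_encode] by (simp add: open_map_def)
  moreover have "encode ` (\<lambda>(z, s). (orbit z, s)) ` Q = orbit_pr ` Q"
    by (simp add: image_image orbit_pr_def case_prod_unfold)
  ultimately show ?thesis by simp
qed

lemma open_map_orbit_pr: "open_map (top_of_set (U \<times> unit_disk)) Ytop orbit_pr"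
proof -
  have "open (U \<times> unit_disk)" by (simp add: open_Times open_U)
  then show ?thesis unfolding open_map_def by (auto simp: openin_open_eq intro: openin_orbit_pr_image)
qed

lemma topspace_Ytop_orbit_pr: "topspace Ytop = orbit_pr ` (U \<times> unit_disk)"
  unfolding topspace_Ytop by (force simp: orbit_pr_def image_iff)

lemma second_countable_Ytop: "second_countable Ytop"
  by (rule second_countable_open_map_image[OF continuous_map_orbit_pr open_map_orbit_pr])
    (simp_all only: topspace_Ytop_orbit_pr topspace_euclidean_subtopology second_countable_top_of_set)

lemma orbit_pr_eq_iff:
  assumes "z \<in> U" "s \<in> unit_disk" "z' \<in> U" "s' \<in> unit_disk"
  shows "orbit_pr (z, s) = orbit_pr (z', s') \<longleftrightarrow> s = s' \<and> (\<exists>a b. z' = deck a b z)"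
proof -
  have "orbit_pr (z, s) = orbit_pr (z', s') \<longleftrightarrow> (orbit z, s) = (orbit z', s')"
    unfolding orbit_pr_def using inj_on_eq_iff[OF inj_encode, of "(orbit z, s)" "(orbit z', s')"] assms by simp
  then show ?thesis by (auto simp: orbit_eq_iff)
qed

lemma orbit_pr_deck [simp]: "orbit_pr (deck a b z, s) = orbit_pr (z, s)"
  by (simp add: orbit_pr_def)

section \<open>Holomorphic charts of the total space\<close>

text \<open>The sheet \<open>V\<close> selects a representative in \<open>U\<close>, to which the
  twisted coordinates of branch \<open>k\<close> are applied. The branch is part of the data, as a
  sheet inside both halves carries two different charts.\<close>

definition chartY :: "bool \<Rightarrow> (complex^4) set \<Rightarrow> ((nat \<times> (complex^5)) set, 5) chart" where
  "chartY k V = (orbit_pr ` (V \<times> unit_disk), \<lambda>y. coord k (the_inv_into V orbit (fst (decode y)), snd (decode y)))"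

definition sheetY :: "bool \<Rightarrow> (complex^4) set \<Rightarrow> bool" where
  "sheetY k V \<longleftrightarrow> sheet V \<and> V \<subseteq> branch_dom k"

definition Y :: "((nat \<times> (complex^5)) set, 5) cmanifold" where
  "Y = \<lparr>mtop = Ytop, atlas = {chartY k V | k V. sheetY k V}\<rparr>"

lemma mtop_Y [simp]: "mtop Y = Ytop"
  by (simp add: Y_def)

lemma atlas_Y: "atlas Y = {chartY k V | k V. sheetY k V}"
  by (simp add: Y_def)

lemma sheetY_D: "sheetY k V \<Longrightarrow> sheet V" "sheetY k V \<Longrightarrow> V \<subseteq> U" "sheetY k V \<Longrightarrow> V \<subseteq> branch_dom k" "sheetY k V \<Longrightarrow> open V"
  by (auto simp: sheetY_def sheet_def)

lemma decode_orbit_pr [simp]: "z \<in> U \<Longrightarrow> s \<in> unit_disk \<Longrightarrow> decode (orbit_pr (z, s)) = (orbit z, s)"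
  by (simp add: orbit_pr_def)

lemma snd_chartY:
  assumes "sheetY k V" "deck a b z \<in> V" "s \<in> unit_disk"
  shows "snd (chartY k V) (orbit_pr (z, s)) = coord k (deck a b z, s)"
proof -
  have "z \<in> U" using assms(2) sheetY_D(2)[OF assms(1)] deck_in_U by blast
  moreover have "the_inv_into V orbit (orbit z) = deck a b z"
    using local_branch[OF sheetY_D(1)[OF assms(1)] assms(2)] by simp
  ultimately show ?thesis using assms(3) by (simp add: chartY_def)
qed

lemma snd_chartY_self:
  "sheetY k V \<Longrightarrow> z \<in> V \<Longrightarrow> s \<in> unit_disk \<Longrightarrow> snd (chartY k V) (orbit_pr (z, s)) = coord k (z, s)"
  using snd_chartY[of k V 0 0 z s] by simp

lemma chartY_image: "sheetY k V \<Longrightarrow> snd (chartY k V) ` fst (chartY k V) = coord k ` (V \<times> unit_disk)"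
proof -
  assume g: "sheetY k V"
  have "snd (chartY k V) ` orbit_pr ` (V \<times> unit_disk) = coord k ` (V \<times> unit_disk)"
    unfolding image_image by (rule image_cong) (auto simp: snd_chartY_self g)
  then show ?thesis by (simp add: chartY_def)
qed

lemma orbit_pr_in_chartY:
  assumes "sheetY k V" "z \<in> U" "s \<in> unit_disk"
  shows "orbit_pr (z, s) \<in> fst (chartY k V) \<longleftrightarrow> (\<exists>a b. deck a b z \<in> V)"
proof
  assume "orbit_pr (z, s) \<in> fst (chartY k V)"
  then obtain z' s' where z': "z' \<in> V" "s' \<in> unit_disk" "orbit_pr (z, s) = orbit_pr (z', s')" by (auto simp: chartY_def)
  then show "\<exists>a b. deck a b z \<in> V"
    using orbit_pr_eq_iff[OF assms(2,3), of z' s'] sheetY_D(2)[OF assms(1)] by blast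
next
  assume "\<exists>a b. deck a b z \<in> V"
  then obtain a b where "deck a b z \<in> V" by blast
  then have "(deck a b z, s) \<in> V \<times> unit_disk" using assms(3) by simp
  then have "orbit_pr (deck a b z, s) \<in> fst (chartY k V)" unfolding chartY_def fst_conv by (rule imageI)
  then show "orbit_pr (z, s) \<in> fst (chartY k V)" by simp
qed

lemma inj_on_orbit_pr: "sheetY k V \<Longrightarrow> inj_on orbit_pr (V \<times> unit_disk)"
proof (rule inj_onI)
  fix p p' assume g: "sheetY k V" and p: "p \<in> V \<times> unit_disk" "p' \<in> V \<times> unit_disk" "orbit_pr p = orbit_pr p'"
  obtain z s z' s' where zs: "p = (z, s)" "p' = (z', s')" "z \<in> V" "z' \<in> V" "s \<in> unit_disk" "s' \<in> unit_disk"
    using p by blast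
  then have "z \<in> U" "z' \<in> U" using sheetY_D(2)[OF g] by blast+
  then have "(orbit z, s) = (orbit z', s')" using decode_orbit_pr zs p(3) by metis
  then show "p = p'" using zs sheetY_D(1)[OF g] unfolding sheet_def by (auto dest: inj_onD)
qed

text \<open>The chart is the quotient of two homeomorphisms out of
  \<open>V \<times> unit_disk\<close>: the projection to \<open>Ytop\<close> and
  \<open>coord k\<close>.\<close>

lemma chartY_homeomorphic:
  assumes g: "sheetY k V"
  shows "homeomorphic_map (subtopology Ytop (fst (chartY k V)))
     (top_of_set (snd (chartY k V) ` fst (chartY k V))) (snd (chartY k V))"
proof (rule homeomorphic_map_factor)
  have V: "V \<subseteq> U" "V \<subseteq> branch_dom k" "open V" using sheetY_D g by blast+
  have "open (U \<times> unit_disk)" "open (V \<times> unit_disk)" by (simp_all add: open_Times open_U V)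
  then have "openin (top_of_set (U \<times> unit_disk)) (V \<times> unit_disk)" using V by (auto simp: openin_open_eq)
  then have "homeomorphic_map (subtopology (top_of_set (U \<times> unit_disk)) (V \<times> unit_disk)) (subtopology Ytop (orbit_pr ` (V \<times> unit_disk))) orbit_pr"
    using g by (intro open_map_imp_homeomorphic_onto_image continuous_map_orbit_pr open_map_orbit_pr inj_on_orbit_pr)
  moreover have "subtopology (top_of_set (U \<times> unit_disk)) (V \<times> unit_disk) = top_of_set (V \<times> unit_disk)"
    using V by (metis Sigma_mono inf.absorb_iff2 order_refl subtopology_subtopology)
  ultimately show "homeomorphic_map (top_of_set (V \<times> unit_disk)) (subtopology Ytop (fst (chartY k V))) orbit_pr"
    by (simp add: chartY_def)
  have od: "open (branch_dom k \<times> (UNIV::complex set))" by (simp add: open_Times open_branch_dom)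
  have "homeomorphic_map (subtopology (top_of_set (branch_dom k \<times> UNIV)) (V \<times> unit_disk)) (subtopology euclidean (coord k ` (V \<times> unit_disk))) (coord k)"
  proof (rule open_map_imp_homeomorphic_onto_image)
    show "continuous_map (top_of_set (branch_dom k \<times> UNIV)) euclidean (coord k)" by (simp add: continuous_on_coord)
    show "open_map (top_of_set (branch_dom k \<times> UNIV)) euclidean (coord k)"
      unfolding open_map_def using od by (auto simp: openin_open_eq intro: open_coord_image)
    show "inj_on (coord k) (V \<times> unit_disk)" by (metis inj_on_inverseI coord_inv_coord)
    show "openin (top_of_set (branch_dom k \<times> UNIV)) (V \<times> unit_disk)"
      using od V \<open>open (V \<times> unit_disk)\<close> by (auto simp: openin_open_eq)
  qed
  moreover have "subtopology (top_of_set (branch_dom k \<times> UNIV)) (V \<times> unit_disk) = top_of_set (V \<times> unit_disk)"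
    using V by (metis Sigma_mono inf.absorb_iff2 subset_UNIV subtopology_subtopology)
  ultimately show "homeomorphic_map (top_of_set (V \<times> unit_disk)) (top_of_set (snd (chartY k V) ` fst (chartY k V))) (coord k)"
    unfolding chartY_image[OF g] by simp
  show "snd (chartY k V) (orbit_pr p) = coord k p" if "p \<in> topspace (top_of_set (V \<times> unit_disk))" for p
    using that snd_chartY_self[OF g] by auto
qed

lemma chartY_inv:
  assumes g: "sheetY k V" and "p \<in> V \<times> unit_disk"
  shows "chart_inv (chartY k V) (coord k p) = orbit_pr p"
proof -
  have inj: "inj_on (snd (chartY k V)) (fst (chartY k V))"
  proof -
    have "fst (chartY k V) \<subseteq> topspace Ytop"
      using sheetY_D(2)[OF g] by (auto simp: topspace_Ytop_orbit_pr chartY_def)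
    then show ?thesis
      using homeomorphic_imp_injective_map[OF chartY_homeomorphic[OF g]] by (simp add: Int_absorb1)
  qed
  have "snd (chartY k V) (orbit_pr p) = coord k p" using assms snd_chartY_self[OF g] by auto
  moreover have "orbit_pr p \<in> fst (chartY k V)" using assms(2) unfolding chartY_def by auto
  ultimately show ?thesis
    unfolding chart_inv_def using inj the_inv_into_f_eq by metis
qed

text \<open>The open set \<open>Q\<close> allows further conditions on the representatives of nearby
  points, such as that a given translate lies in another sheet.\<close>

lemma eventually_chartY_inv:
  assumes g: "sheetY k V" and "z \<in> V" "s \<in> unit_disk" "open Q" "(z, s) \<in> Q"
  shows "\<forall>\<^sub>F w in nhds (coord k (z, s)). \<exists>p\<in>Q \<inter> V \<times> unit_disk. w = coord k p \<and> chart_inv (chartY k V) w = orbit_pr p"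
proof -
  have "open (coord k ` (Q \<inter> V \<times> unit_disk))"
    using sheetY_D[OF g] assms(4) by (intro open_coord_image open_Int open_Times) auto
  moreover have "\<exists>p\<in>Q \<inter> V \<times> unit_disk. w = coord k p \<and> chart_inv (chartY k V) w = orbit_pr p"
    if "w \<in> coord k ` (Q \<inter> V \<times> unit_disk)" for w
    using that chartY_inv[OF g] by blast
  ultimately show ?thesis unfolding eventually_nhds using assms by blast
qed

text \<open>The equivariance of \<open>coord\<close> moves the deck transformation outside, and the
  two smooth twists cancel up to the shear, so only holomorphic maps remain.\<close>

lemma eventually_transition_Y:
  assumes g: "sheetY k V" "sheetY k' V'" and z: "z \<in> V" "s \<in> unit_disk" and ab: "deck a b z \<in> V'"
  shows "\<forall>\<^sub>F w in nhds (coord k (z, s)).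
    (snd (chartY k' V') \<circ> chart_inv (chartY k V)) w = deck5 a b (shear k k' w)"
proof -
  have "open ((deck a b -` V') \<times> (UNIV::complex set))"
    using open_vimage[OF sheetY_D(4)[OF g(2)] continuous_on_deck[OF continuous_on_id]] by (simp add: open_Times)
  from eventually_chartY_inv[OF g(1) z this] have "\<forall>\<^sub>F w in nhds (coord k (z, s)).
     \<exists>p\<in>(deck a b -` V') \<times> UNIV \<inter> V \<times> unit_disk. w = coord k p \<and> chart_inv (chartY k V) w = orbit_pr p"
    using ab by simp
  then show ?thesis
  proof eventually_elim
    case (elim w)
    then obtain z s where p: "deck a b z \<in> V'" "z \<in> V" "s \<in> unit_disk" "w = coord k (z, s)"
      "chart_inv (chartY k V) w = orbit_pr (z, s)" by blast
    then have "z \<in> branch_dom k" "z \<in> branch_dom k'" using sheetY_D(3)[OF g(1)] sheetY_D(3)[OF g(2)] deck_in_branch_dom by blast+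
    then have "coord k' (z, s) = shear k k' w" unfolding p(4) by (rule coord_trans)
    then show ?case
      using snd_chartY[OF g(2) p(1,3)] by (simp add: p(5) coord_deck)
  qed
qed

lemma holo_at_trans:
  assumes "k \<noteq> k' \<Longrightarrow> w$1 \<noteq> 0 \<and> w$3 \<noteq> 0"
  shows "holo_at (\<lambda>w. deck5 a b (shear k k' w) $ i) w"
proof -
  have "holo_at (\<lambda>w::complex^5. w$4 / (w$1 * w$3)) w" if "k \<noteq> k'"
    using assms[OF that] by (intro holo_at_divide holo_at_mult holo_at_nth) simp
  then have shift: "holo_at (\<lambda>w. shift k k' w) w"
    unfolding shift_def by (cases "k = k'"; cases k') (auto intro: holo_at_minus)
  then show ?thesis
    using exhaust_5[of i] by (auto intro!: holo_at_mult holo_at_add shift)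
qed

lemma chartY_cover:
  assumes "z \<in> branch_dom k"
  obtains V where "sheetY k V" "z \<in> V"
proof -
  obtain V where "open V" "z \<in> V" "V \<subseteq> U" "inj_on orbit V"
    using orbit_locally_inj assms branch_dom_subset by blast
  then have "sheetY k (V \<inter> branch_dom k)" "z \<in> V \<inter> branch_dom k"
    using assms open_branch_dom by (auto simp: sheetY_def sheet_def intro: inj_on_subset)
  then show ?thesis by (rule that)
qed

lemma orbit_pr_in_overlap:
  assumes g: "sheetY k V" "sheetY k' V'" and y: "y \<in> fst (chartY k V) \<inter> fst (chartY k' V')"
  obtains z s a b where "y = orbit_pr (z, s)" "z \<in> V" "s \<in> unit_disk" "deck a b z \<in> V'"
proof -
  from y obtain z s where z: "y = orbit_pr (z, s)" "z \<in> V" "s \<in> unit_disk" by (auto simp: chartY_def)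
  then obtain a b where "deck a b z \<in> V'"
    using orbit_pr_in_chartY[OF g(2), of z s] y sheetY_D(2)[OF g(1)] by auto
  then show ?thesis using that z by blast
qed

lemma complex_manifold_Y: "complex_manifold Y"
  unfolding complex_manifold_def mtop_Y
proof (intro conjI ballI)
  show "Hausdorff_space Ytop" by (rule Hausdorff_Ytop)
  show "second_countable Ytop" by (rule second_countable_Ytop)
  show "(\<Union>c\<in>atlas Y. fst c) = topspace Ytop"
    unfolding topspace_Ytop_orbit_pr
  proof
    show "(\<Union>c\<in>atlas Y. fst c) \<subseteq> orbit_pr ` (U \<times> unit_disk)"
      using sheetY_D(2) by (fastforce simp: atlas_Y chartY_def)
    show "orbit_pr ` (U \<times> unit_disk) \<subseteq> (\<Union>c\<in>atlas Y. fst c)"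
    proof
      fix y assume "y \<in> orbit_pr ` (U \<times> unit_disk)"
      then obtain z s where z: "z \<in> U" "s \<in> unit_disk" "y = orbit_pr (z, s)" by auto
      then obtain k where "z \<in> branch_dom k" using U_eq_branch_dom by blast
      then obtain V where V: "sheetY k V" "z \<in> V" by (rule chartY_cover)
      then have "y \<in> fst (chartY k V)" using z unfolding chartY_def by auto
      then show "y \<in> (\<Union>c\<in>atlas Y. fst c)" unfolding atlas_Y using V(1) by blast
    qed
  qed
next
  fix c assume "c \<in> atlas Y"
  then obtain k V where g: "sheetY k V" and c: "c = chartY k V" by (auto simp: atlas_Y)
  have V: "V \<subseteq> U" "V \<subseteq> branch_dom k" "open V" using sheetY_D g by blast+
  show "openin Ytop (fst c)"
    using V by (simp add: c chartY_def) (intro openin_orbit_pr_image open_Times, auto)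
  show "open (snd c ` fst c)"
    unfolding c chartY_image[OF g] using V by (intro open_coord_image open_Times) auto
  show "homeomorphic_map (subtopology Ytop (fst c)) (top_of_set (snd c ` fst c)) (snd c)"
    unfolding c by (rule chartY_homeomorphic[OF g])
next
  fix c d assume "c \<in> atlas Y" "d \<in> atlas Y"
  then obtain k V k' V' where g: "sheetY k V" "sheetY k' V'" and c: "c = chartY k V" and d: "d = chartY k' V'"
    by (auto simp: atlas_Y)
  show "holo_on (snd d \<circ> chart_inv c) (snd c ` (fst c \<inter> fst d))"
  proof (rule holo_onI)
    fix w assume "w \<in> snd c ` (fst c \<inter> fst d)"
    then obtain y where y: "y \<in> fst c \<inter> fst d" "w = snd c y" by blast
    obtain z s a b where z: "y = orbit_pr (z, s)" "z \<in> V" "s \<in> unit_disk" "deck a b z \<in> V'"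
      using orbit_pr_in_overlap[OF g] y(1) unfolding c d by metis
    have w: "w = coord k (z, s)" using snd_chartY_self[OF g(1) z(2,3)] y(2) z(1) c by simp
    have "z \<in> branch_dom k" "z \<in> branch_dom k'" using z sheetY_D(3)[OF g(1)] sheetY_D(3)[OF g(2)] deck_in_branch_dom by blast+
    then have "holo_at (\<lambda>w. deck5 a b (shear k k' w) $ i) w" for i
      by (intro holo_at_trans) (auto simp: w branch_dom_def split: if_splits)
    then show "\<exists>g. (\<forall>\<^sub>F w in nhds w. (snd d \<circ> chart_inv c) w = g w) \<and> (\<forall>i. holo_at (\<lambda>w. g w $ i) w)"
      using eventually_transition_Y[OF g z(2-4)] unfolding w c d
      by (intro exI[of _ "\<lambda>w. deck5 a b (shear k k' w)"]) simp
  qed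
qed

section \<open>The disk\<close>

definition dchart :: "real \<Rightarrow> (complex, 1) chart" where
  "dchart r = (ball 0 r, \<lambda>s. vec s)"

lemma atlas_disk: "atlas (disk r) = {dchart r}"
  by (simp add: disk_def dchart_def)

lemma mtop_disk [simp]: "mtop (disk r) = top_of_set (ball 0 r)"
  by (simp add: disk_def)

lemma charts_at_disk: "s \<in> ball 0 r \<Longrightarrow> charts_at (disk r) s = {dchart r}"
  by (auto simp: charts_at_def atlas_disk) (simp_all add: dchart_def)

lemma linear_vec: "linear (vec :: complex \<Rightarrow> complex^1)"
  by (rule linearI) (simp_all add: vec_eq_iff)

lemma complex_manifold_disk: "complex_manifold (disk r)"
proof -
  define B :: "complex set" where "B = ball 0 r"
  have img: "vec ` B = (\<lambda>v::complex^1. v $ 1) -` B"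
    by (auto simp: image_iff vec_eq_iff)
  have "open ((\<lambda>v::complex^1. v $ 1) -` B)"
    unfolding B_def by (intro open_vimage open_ball continuous_intros)
  then have o: "open (vec ` B :: (complex^1) set)" by (simp add: img)
  have "homeomorphic_maps (top_of_set B) (top_of_set (vec ` B)) (vec :: complex \<Rightarrow> complex^1) (\<lambda>v. v $ 1)"
    unfolding homeomorphic_maps_def
    using linear_continuous_on[OF linear_vec[unfolded linear_conv_bounded_linear]]
    by (auto simp: vec_eq_iff intro!: continuous_intros)
  then have h: "homeomorphic_map (top_of_set B) (top_of_set (vec ` B)) (vec :: complex \<Rightarrow> complex^1)"
    by (rule homeomorphic_maps_imp_map)
  have "holo_on ((vec :: complex \<Rightarrow> complex^1) \<circ> chart_inv (dchart r)) (vec ` B)"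
  proof (rule holo_onI)
    fix w :: "complex^1" assume w: "w \<in> vec ` B"
    have "(vec \<circ> chart_inv (dchart r)) w = w" if "w \<in> vec ` B" for w :: "complex^1"
      using that unfolding chart_inv_def dchart_def B_def
      by (auto simp: the_inv_into_f_f inj_on_def vec_eq_iff)
    then have "\<forall>\<^sub>F w in nhds w. (vec \<circ> chart_inv (dchart r)) w = w"
      using o w unfolding eventually_nhds by blast
    then show "\<exists>g. (\<forall>\<^sub>F w in nhds w. ((vec :: complex \<Rightarrow> complex^1) \<circ> chart_inv (dchart r)) w = g w) \<and> (\<forall>i. holo_at (\<lambda>w. g w $ i) w)"
      by (intro exI[of _ "\<lambda>w :: complex^1. w"]) auto
  qed
  moreover have "subtopology (top_of_set B) B = top_of_set B" by (simp add: subtopology_subtopology)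
  ultimately show ?thesis
    unfolding complex_manifold_def atlas_disk mtop_disk using o h
    by (simp add: dchart_def Hausdorff_space_subtopology second_countable_top_of_set flip: B_def)
qed

text \<open>With a single chart the only transition is the identity, so compatibility imposes
  nothing.\<close>

lemma tangent_space_disk:
  assumes "s \<in> ball 0 r"
  shows "t \<in> tangent_space (disk r) s \<longleftrightarrow> (\<forall>c. c \<noteq> dchart r \<longrightarrow> t c = 0)"
proof -
  have "dchart r \<in> charts_at (disk r) s" using charts_at_disk[OF assms] by simp
  from transition_self[OF complex_manifold_disk this]
  show ?thesis unfolding tangent_space_iff charts_at_disk[OF assms] by simp
qed

section \<open>The family\<close>

definition family_proj :: "(nat \<times> (complex^5)) set \<Rightarrow> complex" where
  "family_proj y = snd (decode y)"

lemma family_proj_orbit_pr [simp]: "z \<in> U \<Longrightarrow> s \<in> unit_disk \<Longrightarrow> family_proj (orbit_pr (z, s)) = s"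
  by (simp add: family_proj_def)

lemma homeomorphic_map_decode: "homeomorphic_map Ytop PX decode"
  using homeomorphic_maps_decode homeomorphic_maps_map by blast

lemma proper_map_family_proj: "proper_map Ytop (top_of_set unit_disk) family_proj"
proof -
  have "proper_map PX (top_of_set unit_disk) snd"
    unfolding proper_map_def
  proof (intro conjI ballI)
    show "closed_map PX (top_of_set unit_disk) snd" by (rule closed_map_snd[OF compact_space_X])
    fix s assume "s \<in> topspace (top_of_set unit_disk)"
    then have "{q \<in> topspace PX. snd q = s} = topspace (mtop X) \<times> {s}" by auto
    moreover have "compactin PX (topspace (mtop X) \<times> {s})"
      using compact_space_X \<open>s \<in> topspace (top_of_set unit_disk)\<close> by (auto simp: compactin_Times compact_space_def)
    ultimately show "compactin PX {q \<in> topspace PX. snd q = s}" by simp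
  qed
  then have "proper_map Ytop (top_of_set unit_disk) (snd \<circ> decode)"
    using proper_map_compose homeomorphic_imp_proper_map[OF homeomorphic_map_decode] by blast
  moreover have "snd \<circ> decode = family_proj" by (auto simp: family_proj_def)
  ultimately show ?thesis by simp
qed

lemma continuous_map_family_proj: "continuous_map Ytop (top_of_set unit_disk) family_proj"
proof -
  have "continuous_map Ytop (top_of_set unit_disk) (snd \<circ> decode)"
    using continuous_map_compose[OF homeomorphic_imp_continuous_map[OF homeomorphic_map_decode] continuous_map_snd] .
  moreover have "snd \<circ> decode = family_proj" by (auto simp: family_proj_def)
  ultimately show ?thesis by simp
qed

text \<open>Both kinds of coordinates keep \<open>s\<close> as fifth entry, so the projection is
  linear in every chart; holomorphy and surjectivity of the differential are read off from this
  form.\<close>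

lemma eventually_family_proj:
  assumes g: "sheetY k V" and "z \<in> V" "s \<in> unit_disk"
  shows "\<forall>\<^sub>F w in nhds (coord k (z, s)).
    (snd (dchart 1) \<circ> family_proj \<circ> chart_inv (chartY k V)) w = vec (w $ 5)"
  using eventually_chartY_inv[OF assms open_UNIV UNIV_I]
proof eventually_elim
  case (elim w)
  then obtain z s where "z \<in> V" "s \<in> unit_disk" "w = coord k (z, s)" "chart_inv (chartY k V) w = orbit_pr (z, s)" by blast
  then show ?case using sheetY_D(2)[OF g] by (auto simp: dchart_def)
qed

lemma charts_at_Y:
  assumes "y \<in> topspace Ytop" "c \<in> charts_at Y y"
  obtains k V z s where "sheetY k V" "c = chartY k V" "z \<in> V" "s \<in> unit_disk" "y = orbit_pr (z, s)"
    "snd c y = coord k (z, s)"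
proof -
  obtain k V where g: "sheetY k V" and c: "c = chartY k V" "y \<in> fst c"
    using assms(2) by (auto simp: charts_at_def atlas_Y)
  then obtain z s where z: "z \<in> V" "s \<in> unit_disk" "y = orbit_pr (z, s)" by (auto simp: chartY_def)
  then have "snd c y = coord k (z, s)" using snd_chartY_self[OF g] c by simp
  then show ?thesis using that g c(1) z by blast
qed

lemma family_proj_derivative:
  assumes "y \<in> topspace Ytop" "c \<in> charts_at Y y"
  shows "((snd (dchart 1) \<circ> family_proj \<circ> chart_inv c) has_derivative (\<lambda>h. vec (h $ 5))) (at (snd c y))"
proof -
  obtain k V z s where c: "sheetY k V" "c = chartY k V" "z \<in> V" "s \<in> unit_disk" "y = orbit_pr (z, s)" "snd c y = coord k (z, s)"
    by (rule charts_at_Y[OF assms])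
  have "bounded_linear (\<lambda>h::complex^5. vec (h $ 5) :: complex^1)"
    by (intro bounded_linear_compose[OF _ bounded_linear_vec_nth]) (simp add: linear_vec flip: linear_conv_bounded_linear)
  then have "((\<lambda>w::complex^5. vec (w $ 5) :: complex^1) has_derivative (\<lambda>h. vec (h $ 5))) (at (snd c y))"
    by (rule bounded_linear_imp_has_derivative)
  moreover have "\<forall>\<^sub>F w in nhds (snd c y). (snd (dchart 1) \<circ> family_proj \<circ> chart_inv c) w = vec (w $ 5)"
    using eventually_family_proj[OF c(1,3,4)] c(2,6) by simp
  ultimately show ?thesis by (rule has_derivative_eventually)
qed

lemma family_proj_in_ball: "y \<in> topspace Ytop \<Longrightarrow> family_proj y \<in> unit_disk"
  using continuous_map_image_subset_topspace[OF continuous_map_family_proj] by auto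

lemma holomorphic_map_family_proj: "holomorphic_map Y (disk 1) family_proj"
  unfolding holomorphic_map_def atlas_disk
proof (intro conjI ballI complex_manifold_Y complex_manifold_disk)
  show "continuous_map (mtop Y) (mtop (disk 1)) family_proj" by (simp add: continuous_map_family_proj)
  fix c d assume c: "c \<in> atlas Y" and "d \<in> {dchart 1}"
  then have d: "d = dchart 1" by simp
  show "holo_on (snd d \<circ> family_proj \<circ> chart_inv c) (snd c ` {x \<in> fst c. family_proj x \<in> fst d})"
  proof (rule holo_onI)
    fix w assume "w \<in> snd c ` {x \<in> fst c. family_proj x \<in> fst d}"
    then obtain y where y: "y \<in> fst c" "w = snd c y" by blast
    then have yc: "c \<in> charts_at Y y" using c by (simp add: charts_at_def)
    have yt: "y \<in> topspace Ytop"
      using chart_open[OF complex_manifold_Y c] y(1) openin_subset by (metis mtop_Y subsetD)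
    obtain k V z s where c': "sheetY k V" "c = chartY k V" "z \<in> V" "s \<in> unit_disk" "y = orbit_pr (z, s)" "snd c y = coord k (z, s)"
      by (rule charts_at_Y[OF yt yc])
    show "\<exists>g. (\<forall>\<^sub>F w in nhds w. (snd d \<circ> family_proj \<circ> chart_inv c) w = g w) \<and> (\<forall>i. holo_at (\<lambda>w. g w $ i) w)"
      using eventually_family_proj[OF c'(1,3,4)] c'(2,6) y(2) d
      by (intro exI[of _ "\<lambda>w. vec (w $ 5) :: complex^1"]) auto
  qed
qed

text \<open>\<open>differential\<close> uses an arbitrarily selected chart. The existential hides
  the selection, so that later computations run in whichever chart it is.\<close>

lemma differential_family_proj:
  assumes y: "y \<in> topspace Ytop"
  shows "\<exists>c\<in>charts_at Y y. \<forall>t.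
    differential Y (disk 1) family_proj y t = (\<lambda>d. if d = dchart 1 then vec (t c $ 5) else 0)"
proof -
  define c where "c = (SOME c. c \<in> charts_at Y y)"
  have "\<exists>c. c \<in> charts_at Y y" using charts_at_nonempty[OF complex_manifold_Y, of y] y by auto
  then have c: "c \<in> charts_at Y y" unfolding c_def by (rule someI_ex)
  have "differential Y (disk 1) family_proj y t = (\<lambda>d. if d = dchart 1 then vec (t c $ 5) else 0)" for t
    unfolding differential_def Let_def c_def[symmetric] charts_at_disk[OF family_proj_in_ball[OF y]]
    using frechet_derivative_eqI[OF family_proj_derivative[OF y c]] by auto
  then show ?thesis using c by blast
qed

lemma holomorphic_submersion_family_proj: "holomorphic_submersion Y (disk 1) family_proj"
  unfolding holomorphic_submersion_def
proof (intro conjI ballI holomorphic_map_family_proj)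
  fix y assume "y \<in> topspace (mtop Y)"
  then have y: "y \<in> topspace Ytop" by simp
  obtain c where c: "c \<in> charts_at Y y"
    "\<And>t. differential Y (disk 1) family_proj y t = (\<lambda>d. if d = dchart 1 then vec (t c $ 5) else 0)"
    using differential_family_proj[OF y] by blast
  show "differential Y (disk 1) family_proj y ` tangent_space Y y = tangent_space (disk 1) (family_proj y)"
  proof
    show "differential Y (disk 1) family_proj y ` tangent_space Y y \<subseteq> tangent_space (disk 1) (family_proj y)"
      using c(2) by (auto simp: tangent_space_disk[OF family_proj_in_ball[OF y]])
    show "tangent_space (disk 1) (family_proj y) \<subseteq> differential Y (disk 1) family_proj y ` tangent_space Y y"
    proof
      fix t assume t: "t \<in> tangent_space (disk 1) (family_proj y)"
      define t' where "t' = tangent_of Y y c (axis 5 (t (dchart 1) $ 1))"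
      have "t' c = axis 5 (t (dchart 1) $ 1)"
        unfolding t'_def by (rule tangent_of_self[OF complex_manifold_Y c(1)])
      then have "differential Y (disk 1) family_proj y t' = t"
        using t by (auto simp: c(2) tangent_space_disk[OF family_proj_in_ball[OF y]] vec_eq_iff axis_def)
      moreover have "t' \<in> tangent_space Y y"
        unfolding t'_def by (rule tangent_of_in[OF complex_manifold_Y c(1)])
      ultimately show "t \<in> differential Y (disk 1) family_proj y ` tangent_space Y y" by blast
    qed
  qed
qed

section \<open>The inclusion of the central fibre\<close>

definition central_incl :: "(complex^4) set \<Rightarrow> (nat \<times> (complex^5)) set" where
  "central_incl A = encode (A, 0)"

lemma central_incl_orbit [simp]: "central_incl (orbit z) = orbit_pr (z, 0)"
  by (simp add: central_incl_def orbit_pr_def)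

lemma zero_in_unit_disk [simp]: "0 \<in> unit_disk"
  by simp

lemma continuous_map_central_incl: "continuous_map (mtop X) Ytop central_incl"
proof -
  have "continuous_map (mtop X) PX (\<lambda>A. (A, 0))"
    by (intro continuous_map_pairedI) (auto simp: continuous_map_id[unfolded id_def])
  from continuous_map_compose[OF this homeomorphic_imp_continuous_map[OF homeomorphic_map_encode]]
  have "continuous_map (mtop X) Ytop (encode \<circ> (\<lambda>A. (A, 0)))" .
  moreover have "encode \<circ> (\<lambda>A. (A, 0)) = central_incl" by (auto simp: central_incl_def)
  ultimately show ?thesis by simp
qed

lemma embedding_map_central_incl: "embedding_map (mtop X) Ytop central_incl"
proof (rule continuous_imp_embedding_map[OF continuous_map_central_incl compact_space_X Hausdorff_Ytop])
  show "inj_on central_incl (topspace (mtop X))"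
  proof (rule inj_onI)
    fix A B assume "A \<in> topspace (mtop X)" "B \<in> topspace (mtop X)" "central_incl A = central_incl B"
    then have "(A, 0::complex) = (B, 0)"
      using inj_onD[OF inj_encode] unfolding central_incl_def topspace_X by (metis SigmaI zero_in_unit_disk)
    then show "A = B" by simp
  qed
qed

lemma continuous_map_fibre: "continuous_map (top_of_set U) Ytop (central_incl \<circ> orbit)"
  using continuous_map_compose[OF continuous_map_orbit continuous_map_central_incl] .

text \<open>At \<open>s = 0\<close> the twist vanishes and the coordinates of both branches restrict
  to the standard ones; hence the central fibre carries the original complex structure of
  \<open>X\<close>.\<close>

lemma eventually_fibre:
  assumes g: "sheetY k V" and ab: "deck a b z \<in> V"
  shows "\<forall>\<^sub>F w in nhds z. (snd (chartY k V) \<circ> (central_incl \<circ> orbit)) w = embed5 (deck a b w) 0"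
  using eventually_deck[OF sheetY_D(4)[OF g] ab]
proof eventually_elim
  case (elim w)
  then show ?case using snd_chartY[OF g elim zero_in_unit_disk] by simp
qed

lemma fibre_derivative:
  assumes g: "sheetY k V" and ab: "deck a b z \<in> V"
  shows "((snd (chartY k V) \<circ> (central_incl \<circ> orbit)) has_derivative (\<lambda>h. embed5 (deck a b h) 0)) (at z)"
proof -
  have "linear (\<lambda>h. embed5 (deck a b h) 0)"
    by (rule linearI) (simp_all add: vec5_eq_iff distrib_left)
  then have "((\<lambda>h. embed5 (deck a b h) 0) has_derivative (\<lambda>h. embed5 (deck a b h) 0)) (at z)"
    by (intro bounded_linear_imp_has_derivative) (simp add: linear_conv_bounded_linear)
  then show ?thesis using eventually_fibre[OF assms] by (rule has_derivative_eventually)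
qed

lemma charts_at_fibre:
  assumes "z \<in> U" "c \<in> charts_at Y (orbit_pr (z, 0))"
  obtains k V a b where "sheetY k V" "c = chartY k V" "deck a b z \<in> V"
proof -
  obtain k V where g: "sheetY k V" and c: "c = chartY k V" "orbit_pr (z, 0) \<in> fst c"
    using assms(2) by (auto simp: charts_at_def atlas_Y)
  then show ?thesis using that orbit_pr_in_chartY[OF g assms(1) zero_in_unit_disk] by blast
qed

lemma chartY_at:
  assumes "sheetY k V" "z \<in> V" "s \<in> unit_disk" shows "chartY k V \<in> charts_at Y (orbit_pr (z, s))"
  using assms by (auto simp: charts_at_def atlas_Y chartY_def)

lemma eventually_chartX_central_incl:
  assumes "sheet V" "z \<in> V"
  shows "\<forall>\<^sub>F w in nhds z. (snd d \<circ> central_incl \<circ> chart_inv (chartX V)) w = (snd d \<circ> (central_incl \<circ> orbit)) w"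
proof -
  have "\<forall>\<^sub>F w in nhds z. w \<in> V" using assms by (auto simp: sheet_def eventually_nhds)
  then show ?thesis by eventually_elim (simp add: chartX_inv[OF assms(1)])
qed

lemma holo_at_embed5_deck: "holo_at (\<lambda>w. embed5 (deck a b w) 0 $ i) z"
  using exhaust_5[of i] by (auto simp: holo_at_const holo_at_mult holo_at_nth)

lemma holomorphic_map_central_incl: "holomorphic_map X Y central_incl"
  unfolding holomorphic_map_def
proof (intro conjI ballI complex_manifold_X complex_manifold_Y)
  show "continuous_map (mtop X) (mtop Y) central_incl" by (simp add: continuous_map_central_incl)
  fix c d assume "c \<in> atlas X" "d \<in> atlas Y"
  then obtain V k V' where V: "sheet V" and c: "c = chartX V" and g: "sheetY k V'" and d: "d = chartY k V'"
    by (auto simp: atlas_X atlas_Y)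
  show "holo_on (snd d \<circ> central_incl \<circ> chart_inv c) (snd c ` {x \<in> fst c. central_incl x \<in> fst d})"
  proof (rule holo_onI)
    fix z assume "z \<in> snd c ` {x \<in> fst c. central_incl x \<in> fst d}"
    then obtain z' where "z' \<in> V" "central_incl (orbit z') \<in> fst d" "z = the_inv_into V orbit (orbit z')"
      by (auto simp: c chartX_def)
    then have z: "z \<in> V" "orbit_pr (z, 0) \<in> fst d" using local_branch[OF V] by auto
    moreover have "z \<in> U" using z(1) V by (auto simp: sheet_def)
    ultimately obtain a b where ab: "deck a b z \<in> V'" using orbit_pr_in_chartY[OF g] d zero_in_unit_disk by blast
    have "\<forall>\<^sub>F w in nhds z. (snd d \<circ> central_incl \<circ> chart_inv c) w = embed5 (deck a b w) 0"
      using eventually_chartX_central_incl[OF V z(1), of d] eventually_fibre[OF g ab] unfolding c d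
      by eventually_elim simp
    then show "\<exists>g. (\<forall>\<^sub>F w in nhds z. (snd d \<circ> central_incl \<circ> chart_inv c) w = g w) \<and> (\<forall>i. holo_at (\<lambda>w. g w $ i) z)"
      by (intro exI[of _ "\<lambda>w. embed5 (deck a b w) 0"]) (simp add: holo_at_embed5_deck)
  qed
qed

lemma embed5_deck_inj: "embed5 (deck a b v) 0 = embed5 (deck a b v') 0 \<longleftrightarrow> v = v'"
  by (auto simp: vec5_eq_iff vec4_eq_iff)

lemma holomorphic_embedding_central_incl: "holomorphic_embedding X Y central_incl"
  unfolding holomorphic_embedding_def
proof (intro conjI ballI holomorphic_map_central_incl)
  show "embedding_map (mtop X) (mtop Y) central_incl" by (simp add: embedding_map_central_incl)
  fix A assume A: "A \<in> topspace (mtop X)"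
  define c where "c = (SOME c. c \<in> charts_at X A)"
  have "\<exists>c. c \<in> charts_at X A" using charts_at_nonempty[OF complex_manifold_X A] by auto
  then have c: "c \<in> charts_at X A" unfolding c_def by (rule someI_ex)
  then obtain V where V: "sheet V" "c = chartX V" "A \<in> orbit ` V"
    by (auto simp: charts_at_def atlas_X chartX_def)
  then obtain z where z: "z \<in> V" "A = orbit z" by blast
  have zU: "z \<in> U" using z V by (auto simp: sheet_def)
  have cz: "snd c A = z" using V z local_branch by (simp add: chartX_def)
  have "central_incl A \<in> topspace (mtop Y)"
    using A continuous_map_image_subset_topspace[OF continuous_map_central_incl] by auto
  then obtain d where d: "d \<in> charts_at Y (central_incl A)"
    using charts_at_nonempty[OF complex_manifold_Y] by blast
  obtain k V' a b where g: "sheetY k V'" "d = chartY k V'" "deck a b z \<in> V'"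
    using charts_at_fibre[OF zU, of d] d unfolding z(2) central_incl_orbit by blast
  have "((snd d \<circ> central_incl \<circ> chart_inv c) has_derivative (\<lambda>h. embed5 (deck a b h) 0)) (at (snd c A))"
    using has_derivative_eventually[OF fibre_derivative[OF g(1,3)] eventually_chartX_central_incl[OF V(1) z(1)]]
    unfolding cz unfolding g(2) V(2) .
  from frechet_derivative_eqI[OF this]
  have D: "differential X Y central_incl A t d = embed5 (deck a b (t c)) 0" for t
    unfolding differential_def Let_def c_def[symmetric] using d by simp
  show "inj_on (differential X Y central_incl A) (tangent_space X A)"
  proof (rule inj_onI)
    fix t t' assume t: "t \<in> tangent_space X A" "t' \<in> tangent_space X A"
      and eq: "differential X Y central_incl A t = differential X Y central_incl A t'"
    then have "embed5 (deck a b (t c)) 0 = embed5 (deck a b (t' c)) 0" using D by metis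
    then show "t = t'" using t c by (intro tangent_eqI) (auto simp: embed5_deck_inj)
  qed
qed

lemma central_incl_image: "central_incl ` topspace (mtop X) = {y \<in> topspace Ytop. family_proj y = 0}"
proof
  show "central_incl ` topspace (mtop X) \<subseteq> {y \<in> topspace Ytop. family_proj y = 0}"
    by (auto simp: topspace_X topspace_Ytop_orbit_pr)
  show "{y \<in> topspace Ytop. family_proj y = 0} \<subseteq> central_incl ` topspace (mtop X)"
  proof
    fix y assume "y \<in> {y \<in> topspace Ytop. family_proj y = 0}"
    then obtain z where "z \<in> U" "y = orbit_pr (z, 0)" by (auto simp: topspace_Ytop_orbit_pr)
    then have "y = central_incl (orbit z)" by simp
    then show "y \<in> central_incl ` topspace (mtop X)" unfolding topspace_X using \<open>z \<in> U\<close> by blast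
  qed
qed

section \<open>The differential of the inclusion of the central fibre\<close>

abbreviation fibre :: "complex^4 \<Rightarrow> (nat \<times> (complex^5)) set" where
  "fibre \<equiv> central_incl \<circ> orbit"

lemma fibre_deck [simp]: "fibre (deck a b z) = fibre z"
  by simp

lemma chartY_at_fibre:
  assumes "sheetY k V" "deck a b z \<in> V" shows "chartY k V \<in> charts_at Y (fibre z)"
  using chartY_at[OF assms zero_in_unit_disk] by simp

lemma charts_at_fibreE:
  assumes "z \<in> U" "c \<in> charts_at Y (fibre z)"
  obtains k V a b where "sheetY k V" "c = chartY k V" "deck a b z \<in> V"
  using charts_at_fibre[OF assms(1), of c] assms(2) that unfolding o_apply central_incl_orbit by blast

lemma dmap_fibre:
  assumes "sheetY k V" "deck a b z \<in> V"
  shows "dmap Y fibre z v (chartY k V) = embed5 (deck a b v) 0"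
  unfolding dmap_def using chartY_at_fibre[OF assms] frechet_derivative_eqI[OF fibre_derivative[OF assms]]
  by simp

lemma dmap_outside: "c \<notin> charts_at Y (fibre z) \<Longrightarrow> dmap Y fibre z v c = 0"
  by (simp add: dmap_def)

lemma dmap_fibre_tangent: "z \<in> U \<Longrightarrow> dmap Y fibre z v \<in> tangent_space Y (fibre z)"
proof (rule dmap_in_tangent_space[OF complex_manifold_Y _ open_U])
  show "continuous_map (top_of_set U) (mtop Y) fibre" using continuous_map_fibre by simp
next
  fix c assume "z \<in> U" "c \<in> charts_at Y (fibre z)"
  then obtain k V a b where "sheetY k V" "c = chartY k V" "deck a b z \<in> V" by (rule charts_at_fibreE)
  then show "(snd c \<circ> fibre) differentiable (at z)"
    using fibre_derivative unfolding differentiable_def by blast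
qed

lemma dmap_add:
  assumes z: "z \<in> U" shows "dmap Y fibre z (v + v') = dmap Y fibre z v + dmap Y fibre z v'"
proof
  fix c
  show "dmap Y fibre z (v + v') c = (dmap Y fibre z v + dmap Y fibre z v') c"
  proof (cases "c \<in> charts_at Y (fibre z)")
    case True
    then obtain k V a b where c: "sheetY k V" "c = chartY k V" "deck a b z \<in> V" by (rule charts_at_fibreE[OF z])
    show ?thesis unfolding c(2) plus_fun_def dmap_fibre[OF c(1,3)] by (simp add: vec5_eq_iff distrib_left)
  qed (simp add: dmap_outside)
qed

lemma dmap_zero: assumes "z \<in> U" shows "dmap Y fibre z 0 = 0"
  using dmap_add[OF assms, of 0 0] by simp

lemma dmap_diff: assumes "z \<in> U" shows "dmap Y fibre z (v - v') = dmap Y fibre z v - dmap Y fibre z v'"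
  using dmap_add[OF assms, of "v - v'" v'] by (simp add: algebra_simps)

lemma ex_chart_fibre:
  assumes "z \<in> U" obtains k V where "sheetY k V" "z \<in> V"
  using assms chartY_cover unfolding U_eq_branch_dom by blast

text \<open>Exactness on the left; it brings identities of cochains back from the total space to
  vector fields on \<open>U\<close>.\<close>

lemma dmap_inj:
  assumes "z \<in> U" "dmap Y fibre z v = dmap Y fibre z v'" shows "v = v'"
proof -
  obtain k V where V: "sheetY k V" "z \<in> V" by (rule ex_chart_fibre[OF assms(1)])
  then have "deck 0 0 z \<in> V" by simp
  from dmap_fibre[OF V(1) this, of v] dmap_fibre[OF V(1) this, of v'] assms(2)
  show ?thesis using embed5_deck_inj by metis
qed

text \<open>The chain rule for the invariance \<open>fibre \<circ> g = fibre\<close>, where the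
  linear map \<open>g\<close> is its own derivative. It makes \<open>dmap\<close> compatible with
  the pullbacks along the generators.\<close>

lemma dmap_deck:
  assumes z: "z \<in> U" shows "dmap Y fibre z (deck (- c) (- d) v) = dmap Y fibre (deck c d z) v"
proof
  fix e
  show "dmap Y fibre z (deck (- c) (- d) v) e = dmap Y fibre (deck c d z) v e"
  proof (cases "e \<in> charts_at Y (fibre z)")
    case True
    then obtain k V a b where e: "sheetY k V" "e = chartY k V" "deck a b z \<in> V" by (rule charts_at_fibreE[OF z])
    have "deck (a - c) (b - d) (deck c d z) \<in> V" using e(3) by simp
    from dmap_fibre[OF e(1) this] dmap_fibre[OF e(1,3)] show ?thesis by (simp add: e(2))
  next
    case False
    then have "e \<notin> charts_at Y (fibre (deck c d z))" by simp
    with False show ?thesis using dmap_outside by metis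
  qed
qed

lemma deck_derivative: "frechet_derivative (deck a b) (at z) = deck a b"
proof -
  have "linear (deck a b)" by (rule linearI) (simp_all add: vec4_eq_iff distrib_left)
  then show ?thesis
    by (intro frechet_derivative_eqI bounded_linear_imp_has_derivative) (simp add: linear_conv_bounded_linear)
qed

lemma gen_deck: assumes "\<mu> \<in> {1, 2}" obtains a b where "gen \<mu> = deck a b"
  using assms gen_eq_deck by auto

lemma dmap_pull:
  assumes "z \<in> U" "\<mu> \<in> {1, 2}"
  shows "dmap Y fibre z (pull Theta \<mu> v z) = dmap Y fibre (gen \<mu> z) (v (gen \<mu> z))"
proof -
  obtain a b where "gen \<mu> = deck a b" using gen_deck assms(2) by blast
  then show ?thesis by (simp add: Theta_def deck_derivative inv_deck dmap_deck[OF assms(1)])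
qed

section \<open>The horizontal lifts of \<open>\<partial>\<^sub>s\<close>\<close>

text \<open>By the product rule the derivative of \<open>shift\<close> is multiplied by the fifth
  coordinate, which is \<open>0\<close> on the central fibre. Only the value of \<open>shift\<close>
  remains, as a multiple of the coordinate direction of \<open>u\<close>.\<close>

lemma transition_Y:
  assumes g: "sheetY k V" "sheetY k' V'" and z: "z \<in> V" "deck a b z \<in> V'"
  shows "transition Y (fibre z) (chartY k V) (chartY k' V') h =
    deck5 a b (vector [h$1, h$2 + h$5 * shift k k' (embed5 z 0), h$3, h$4, h$5])"
proof -
  define D where "D = (\<lambda>h :: complex^5. deck5 a b (vector [h$1, h$2 + h$5 * shift k k' (embed5 z 0), h$3, h$4, h$5]))"
  have w: "snd (chartY k V) (fibre z) = embed5 z 0" using snd_chartY_self[OF g(1) z(1) zero_in_unit_disk] by simp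
  have "z \<in> branch_dom k" "z \<in> branch_dom k'" using z sheetY_D(3)[OF g(1)] sheetY_D(3)[OF g(2)] deck_in_branch_dom by blast+
  then have nz: "z$1 \<noteq> 0 \<and> z$3 \<noteq> 0" if "k \<noteq> k'"
    using that by (auto simp: branch_dom_def split: if_splits)
  have "holo_at (\<lambda>w::complex^5. w$4 / (w$1 * w$3)) (embed5 z 0)" if "k \<noteq> k'"
    using nz[OF that] by (intro holo_at_divide holo_at_mult holo_at_nth) simp
  then have "holo_at (shift k k') (embed5 z 0)"
    unfolding shift_def by (cases "k = k'"; cases k') (auto intro: holo_at_minus)
  then obtain L where L: "(shift k k' has_derivative L) (at (embed5 z 0))" unfolding holo_at_def by blast
  have nth: "((\<lambda>w::complex^5. w $ j) has_derivative (\<lambda>h. h $ j)) (at (embed5 z 0))" for j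
    by (intro bounded_linear_imp_has_derivative bounded_linear_vec_nth)
  have cm: "((\<lambda>w::complex^5. q * w $ j) has_derivative (\<lambda>h. q * h $ j)) (at (embed5 z 0))" for j q
    by (intro has_derivative_mult_right nth)
  have "((\<lambda>w. q_pow b * (w$2 + w$5 * shift k k' w)) has_derivative
      (\<lambda>h. q_pow b * (h$2 + (embed5 z 0 $ 5 * L h + h$5 * shift k k' (embed5 z 0))))) (at (embed5 z 0))"
    by (intro has_derivative_mult_right has_derivative_add has_derivative_mult nth L)
  then have c2: "((\<lambda>w. q_pow b * (w$2 + w$5 * shift k k' w)) has_derivative
      (\<lambda>h. q_pow b * (h$2 + h$5 * shift k k' (embed5 z 0)))) (at (embed5 z 0))" by simp
  have "((\<lambda>w. deck5 a b (shear k k' w) $ j) has_derivative (\<lambda>h. D h $ j)) (at (embed5 z 0))" for j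
    using exhaust_5[of j] cm nth c2 by (auto simp: D_def)
  then have "((\<lambda>w. deck5 a b (shear k k' w)) has_derivative D) (at (embed5 z 0))" by (rule has_derivative_vecI)
  moreover have "\<forall>\<^sub>F w in nhds (embed5 z 0). (snd (chartY k' V') \<circ> chart_inv (chartY k V)) w = deck5 a b (shear k k' w)"
    using eventually_transition_Y[OF g z(1) zero_in_unit_disk z(2)] by simp
  ultimately have "((snd (chartY k' V') \<circ> chart_inv (chartY k V)) has_derivative D) (at (embed5 z 0))"
    by (rule has_derivative_eventually)
  from frechet_derivative_eqI[OF this] show ?thesis unfolding transition_def w by (simp add: D_def)
qed

text \<open>The coordinate field of the fifth coordinate of branch \<open>k\<close>, along the
  central fibre. An arbitrary sheet may be selected, because charts of one branch differ by deck
  transformations, which fix this direction.\<close>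

definition ds_lift :: "bool \<Rightarrow> complex^4 \<Rightarrow> (((nat \<times> (complex^5)) set), 5) tangent" where
  "ds_lift k z = tangent_of Y (fibre z) (SOME c. \<exists>V. sheetY k V \<and> z \<in> V \<and> c = chartY k V) (axis 5 1)"

lemma ds_lift_chart:
  assumes "z \<in> branch_dom k"
  obtains V where "sheetY k V" "z \<in> V" "chartY k V \<in> charts_at Y (fibre z)"
    "ds_lift k z = tangent_of Y (fibre z) (chartY k V) (axis 5 1)"
proof -
  define c where "c = (SOME c. \<exists>V. sheetY k V \<and> z \<in> V \<and> c = chartY k V)"
  have "\<exists>c. \<exists>V. sheetY k V \<and> z \<in> V \<and> c = chartY k V" using chartY_cover[OF assms] by metis
  then have "\<exists>V. sheetY k V \<and> z \<in> V \<and> c = chartY k V" unfolding c_def by (rule someI_ex)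
  then obtain V where V: "sheetY k V" "z \<in> V" "c = chartY k V" by blast
  have "chartY k V \<in> charts_at Y (fibre z)" using chartY_at_fibre[OF V(1), of 0 0 z] V(2) by simp
  moreover have "ds_lift k z = tangent_of Y (fibre z) (chartY k V) (axis 5 1)"
    unfolding ds_lift_def c_def[symmetric] V(3) ..
  ultimately show ?thesis using that V by blast
qed

lemma ds_lift_tangent: "z \<in> branch_dom k \<Longrightarrow> ds_lift k z \<in> tangent_space Y (fibre z)"
  using ds_lift_chart tangent_of_in[OF complex_manifold_Y] by metis

lemma ds_lift_eq:
  assumes z: "z \<in> branch_dom k" and g: "sheetY k' V'" "deck a b z \<in> V'"
  shows "ds_lift k z (chartY k' V') = deck5 a b (vector [0, shift k k' (embed5 z 0), 0, 0, 1])"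
proof -
  obtain V where V: "sheetY k V" "z \<in> V" "chartY k V \<in> charts_at Y (fibre z)"
    "ds_lift k z = tangent_of Y (fibre z) (chartY k V) (axis 5 1)" by (rule ds_lift_chart[OF z])
  have "ds_lift k z (chartY k' V') = transition Y (fibre z) (chartY k V) (chartY k' V') (axis 5 1)"
    unfolding V(4) tangent_of_def using chartY_at_fibre[OF g] by simp
  also have "\<dots> = deck5 a b (vector [0, shift k k' (embed5 z 0), 0, 0, 1])"
    unfolding transition_Y[OF V(1) g(1) V(2) g(2)] by (simp add: axis_def)
  finally show ?thesis .
qed

text \<open>This invariance makes the group components of the coboundary vanish, as those of
  \<open>eta_cocycle\<close> do.\<close>

lemma ds_lift_deck:
  assumes z: "z \<in> branch_dom k" shows "ds_lift k (deck a b z) = ds_lift k z"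
proof -
  obtain V where V: "sheetY k V" "z \<in> V" using chartY_cover[OF z] .
  have z': "deck a b z \<in> branch_dom k" using z by simp
  have "deck 0 0 z \<in> V" "deck (- a) (- b) (deck a b z) \<in> V" using V(2) by simp_all
  from ds_lift_eq[OF z V(1) this(1)] ds_lift_eq[OF z' V(1) this(2)]
  have "ds_lift k (deck a b z) (chartY k V) = ds_lift k z (chartY k V)"
    by (simp add: shift_def vec5_eq_iff)
  moreover have "ds_lift k (deck a b z) \<in> tangent_space Y (fibre z)"
    using ds_lift_tangent[OF z'] unfolding fibre_deck .
  moreover have "chartY k V \<in> charts_at Y (fibre z)" using chartY_at_fibre[OF V(1), of 0 0 z] V(2) by simp
  ultimately show ?thesis using ds_lift_tangent[OF z] by (intro tangent_eqI)
qed

text \<open>Read in a chart of branch \<open>False\<close>, the lift of branch \<open>True\<close>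
  has to be shifted back and gains \<open>+ v/(xy)\<close> in direction \<open>u\<close>. This is
  why the gluing follows the flow of \<open>- W\<close> in order to produce
  \<open>+ W\<close>.\<close>

lemma ds_lift_diff:
  assumes "z \<in> branch_dom False" "z \<in> branch_dom True"
  shows "ds_lift True z - ds_lift False z = dmap Y fibre z (W z)"
proof -
  obtain V where V: "sheetY False V" "z \<in> V" using chartY_cover[OF assms(1)] .
  have z: "deck 0 0 z \<in> V" using V(2) by simp
  have "(ds_lift True z - ds_lift False z) (chartY False V) = dmap Y fibre z (W z) (chartY False V)"
    using ds_lift_eq[OF assms(1) V(1) z] ds_lift_eq[OF assms(2) V(1) z] dmap_fibre[OF V(1) z, of "W z"]
    by (simp add: shift_def vec5_eq_iff W_def)
  moreover have "chartY False V \<in> charts_at Y (fibre z)" by (rule chartY_at_fibre[OF V(1) z])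
  moreover have "dmap Y fibre z (W z) \<in> tangent_space Y (fibre z)"
    using dmap_fibre_tangent assms branch_dom_subset by blast
  ultimately show ?thesis
    using tangent_space_diff[OF complex_manifold_Y ds_lift_tangent[OF assms(2)] ds_lift_tangent[OF assms(1)]]
    by (intro tangent_eqI)
qed

lemma holo_at_cmult: "holo_at f z \<Longrightarrow> holo_at (\<lambda>w. c * f w) z"
  by (rule holo_at_mult[OF holo_at_const])

lemma eventually_in_open: "open S \<Longrightarrow> z \<in> S \<Longrightarrow> \<forall>\<^sub>F w in nhds z. w \<in> S"
  by (auto simp: eventually_nhds)

lemma fibre_chart_deck:
  assumes "sheetY k V" "z \<in> U" "fibre z \<in> fst (chartY k V)"
  obtains a b where "deck a b z \<in> V"
  using orbit_pr_in_chartY[OF assms(1,2) zero_in_unit_disk] assms(3) by auto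

lemma ds_lift_section:
  assumes "S \<subseteq> branch_dom k" shows "ds_lift k \<in> sections (pullback_Theta Y fibre) S"
proof -
  have "holo_on (\<lambda>z. ds_lift k z d) {z \<in> S. fibre z \<in> fst d}" if d: "d \<in> atlas Y" for d
  proof (rule holo_onI)
    fix z assume z: "z \<in> {z \<in> S. fibre z \<in> fst d}"
    obtain k' V' where g: "sheetY k' V'" "d = chartY k' V'" using d by (auto simp: atlas_Y)
    have zk: "z \<in> branch_dom k" using z assms by blast
    then obtain a b where ab: "deck a b z \<in> V'" using fibre_chart_deck[OF g(1)] z g(2) branch_dom_subset by blast
    have zk': "z \<in> branch_dom k'" using ab sheetY_D(3)[OF g(1)] deck_in_branch_dom by blast
    have ev: "\<forall>\<^sub>F w in nhds z. ds_lift k w d = deck5 a b (vector [0, shift k k' (embed5 w 0), 0, 0, 1])"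
      using eventually_in_open[OF open_branch_dom zk] eventually_deck[OF sheetY_D(4)[OF g(1)] ab]
      by eventually_elim (simp add: g(2) ds_lift_eq[OF _ g(1)])
    have "z$1 \<noteq> 0 \<and> z$3 \<noteq> 0" if "k \<noteq> k'"
      using that zk zk' by (auto simp: branch_dom_def split: if_splits)
    then have "holo_at (\<lambda>w::complex^4. w$4 / (w$1 * w$3)) z" if "k \<noteq> k'"
      using that by (intro holo_at_divide holo_at_mult holo_at_nth) simp
    then have "holo_at (\<lambda>w. shift k k' (embed5 w 0)) z"
      unfolding shift_def by (cases "k = k'"; cases k') (auto intro: holo_at_minus)
    then have "holo_at (\<lambda>w. deck5 a b (vector [0, shift k k' (embed5 w 0), 0, 0, 1]) $ i) z" for i
      using exhaust_5[of i] by (auto simp: holo_at_cmult holo_at_const)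
    then show "\<exists>g. (\<forall>\<^sub>F w in nhds z. ds_lift k w d = g w) \<and> (\<forall>i. holo_at (\<lambda>w. g w $ i) z)"
      using ev by (intro exI[of _ "\<lambda>w. deck5 a b (vector [0, shift k k' (embed5 w 0), 0, 0, 1])"]) simp
  qed
  then show ?thesis using assms ds_lift_tangent unfolding pullback_Theta_def by auto
qed

section \<open>Exactness of the tangent sequence along the central fibre\<close>

abbreviation family_dproj :: "complex^4 \<Rightarrow> (((nat \<times> (complex^5)) set), 5) tangent \<Rightarrow> (complex, 1) tangent" where
  "family_dproj z \<equiv> differential Y (disk 1) family_proj (fibre z)"

lemma family_dproj_eq:
  assumes z: "z \<in> U"
  obtains k V a b where "sheetY k V" "deck a b z \<in> V"
    "\<forall>t. family_dproj z t = (\<lambda>d. if d = dchart 1 then vec (t (chartY k V) $ 5) else 0)"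
proof -
  have "fibre z \<in> topspace Ytop" using z by (auto simp: topspace_Ytop_orbit_pr)
  from differential_family_proj[OF this] obtain c where c: "c \<in> charts_at Y (fibre z)"
    "\<forall>t. family_dproj z t = (\<lambda>d. if d = dchart 1 then vec (t c $ 5) else 0)" by blast
  from c(1) obtain k V a b where "sheetY k V" "c = chartY k V" "deck a b z \<in> V" by (rule charts_at_fibreE[OF z])
  then show ?thesis using that c(2) by blast
qed

lemma d_ds_eq: "d_ds 1 = (\<lambda>d. if d = dchart 1 then vec 1 else 0)"
  using charts_at_disk[of 0 1] by (auto simp: d_ds_def)

lemma family_dproj_ds_lift_add:
  assumes "z \<in> branch_dom k" shows "family_dproj z (ds_lift k z + dmap Y fibre z v) = d_ds 1"
proof -
  have "z \<in> U" using assms branch_dom_subset by blast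
  then obtain k' V a b where g: "sheetY k' V" "deck a b z \<in> V"
    "\<forall>t. family_dproj z t = (\<lambda>d. if d = dchart 1 then vec (t (chartY k' V) $ 5) else 0)" by (rule family_dproj_eq)
  have five: "(ds_lift k z + dmap Y fibre z v) (chartY k' V) $ 5 = 1"
    by (simp add: ds_lift_eq[OF assms g(1,2)] dmap_fibre[OF g(1,2)])
  show ?thesis unfolding d_ds_eq g(3)[rule_format] five ..
qed

text \<open>Exactness in the middle: two lifts of the same base vector have equal fifth coordinates,
  and a tangent vector with vanishing fifth coordinate is tangent to the fibre.\<close>

lemma family_dproj_exact:
  assumes z: "z \<in> branch_dom k" and t: "t \<in> tangent_space Y (fibre z)" "family_dproj z t = d_ds 1"
  obtains v where "dmap Y fibre z v = t - ds_lift k z"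
proof -
  have zU: "z \<in> U" using z branch_dom_subset by blast
  then obtain k' V a b where g: "sheetY k' V" "deck a b z \<in> V"
    "\<forall>t. family_dproj z t = (\<lambda>d. if d = dchart 1 then vec (t (chartY k' V) $ 5) else 0)" by (rule family_dproj_eq)
  have "vec (t (chartY k' V) $ 5) = (vec 1 :: complex^1)"
    using t(2) unfolding d_ds_eq g(3)[rule_format] by (metis (full_types))
  then have t5: "t (chartY k' V) $ 5 = 1" by (simp add: vec_eq_iff)
  define h where "h = (t - ds_lift k z) (chartY k' V)"
  have h5: "h $ 5 = 0" by (simp add: h_def t5 ds_lift_eq[OF z g(1,2)])
  \<comment> \<open>In this chart \<open>dmap\<close> applies the linear map
    \<open>deck a b\<close>, which is undone here.\<close>
  define v where "v = deck (- a) (- b) (restrict4 h)"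
  have "dmap Y fibre z v (chartY k' V) = h"
    using h5 by (simp add: dmap_fibre[OF g(1,2)] v_def vec5_eq_iff)
  then have "dmap Y fibre z v = t - ds_lift k z"
    using chartY_at_fibre[OF g(1,2)] tangent_space_diff[OF complex_manifold_Y t(1) ds_lift_tangent[OF z]]
      dmap_fibre_tangent[OF zU] unfolding h_def by (intro tangent_eqI)
  then show ?thesis by (rule that)
qed


section \<open>Cochains\<close>

lemma tot_index_0: "(I, M) \<in> tot_index 0 \<longleftrightarrow> (\<exists>i<4. I = {i} \<and> M = {})"
proof
  assume "(I, M) \<in> tot_index 0"
  then have I: "I \<noteq> {}" "I \<subseteq> {..<4}" "M \<subseteq> {1, 2}" "card I + card M = 1" by (auto simp: tot_index_def)
  then have fin: "finite I" "finite M" by (auto intro: finite_subset)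
  then have "card I \<noteq> 0" using I(1) by simp
  then have "card I = 1" "card M = 0" using I(4) by simp_all
  then show "\<exists>i<4. I = {i} \<and> M = {}" using I fin by (auto simp: card_1_singleton_iff)
qed (auto simp: tot_index_def)

lemma tot_index_1:
  assumes "(I, M) \<in> tot_index (Suc 0)"
  obtains (group) i \<mu> where "i < 4" "\<mu> \<in> {1, 2}" "I = {i}" "M = {\<mu>}"
  | (cech) i j where "i < j" "j < 4" "I = {i, j}" "M = {}"
proof -
  have I: "I \<noteq> {}" "I \<subseteq> {..<4}" "M \<subseteq> {1, 2}" "card I + card M = 2" using assms by (auto simp: tot_index_def)
  then have fin: "finite I" "finite M" by (auto intro: finite_subset)
  then have "card I \<noteq> 0" using I(1) by simp
  then consider "card I = 1" "card M = 1" | "card I = 2" "card M = 0" using I(4) by linarith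
  then show ?thesis
  proof cases
    case 1
    then obtain i \<mu> where "I = {i}" "M = {\<mu>}" by (auto simp: card_1_singleton_iff)
    then show ?thesis using I group[of i \<mu>] by auto
  next
    case 2
    then obtain i j where ij: "I = {i, j}" "i \<noteq> j" by (auto simp: card_2_iff)
    have "M = {}" using 2 fin by simp
    then show ?thesis
      using ij I cech[of i j] cech[of j i] by (cases i j rule: linorder_cases) (auto simp: insert_commute)
  qed
qed

lemma d_tot_group: "d_tot A c {i} {\<mu>} z = pull A \<mu> (c {i} {}) z - c {i} {} z"
proof -
  \<comment> \<open>No Cech term occurs: deleting the only chart index would leave the empty
    set.\<close>
  have I: "{l. l \<in> {i} \<and> {i} \<noteq> {l}} = {}" by auto
  have "{j \<in> {\<mu>}. j < \<mu>} = {}" by auto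
  then have "position \<mu> {\<mu>} = 0" unfolding position_def by (simp only: card.empty)
  then show ?thesis unfolding d_tot_def I by (simp add: signed_def)
qed

lemma d_tot_cech:
  assumes "i < j" shows "d_tot A c {i, j} {} z = c {j} {} z - c {i} {} z"
proof -
  have I: "{l. l \<in> {i, j} \<and> {i, j} \<noteq> {l}} = {i, j}" using assms by auto
  have "{l \<in> {i, j}. l < i} = {}" "{l \<in> {i, j}. l < j} = {i}" using assms by auto
  \<comment> \<open>Deleting \<open>i\<close> keeps the value at \<open>j\<close> with sign plus,
    deleting \<open>j\<close> keeps the value at \<open>i\<close> with sign minus.\<close>
  then have pos: "position i {i, j} = 0" "position j {i, j} = 1"
    unfolding position_def by (simp_all only: card.empty) simp
  have "{i, j} - {i} = {j}" "{i, j} - {j} = {i}" using assms by auto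
  then show ?thesis
    using assms unfolding d_tot_def I by (simp add: signed_def pos)
qed

lemma open_chart_U: "open (chart_U {i})"
proof -
  have "chart_U {i} = U \<inter> (\<Inter>j\<in>- face i. {z. z $ j \<noteq> 0})" by (auto simp: chart_U_def)
  moreover have "open (\<Inter>j\<in>- face i. {z :: complex^4. z $ j \<noteq> 0})"
    by (intro open_INT finite ballI open_Collect_neq continuous_intros)
  ultimately show ?thesis using open_U by (metis open_Int)
qed

lemma chart_U_deck: "z \<in> chart_U {i} \<Longrightarrow> deck a b z \<in> chart_U {i}"
proof -
  have "deck a b z $ j = 0 \<longleftrightarrow> z $ j = 0" for j
    using exhaust_4[of j] by auto
  then show "z \<in> chart_U {i} \<Longrightarrow> deck a b z \<in> chart_U {i}" by (simp add: chart_U_def)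
qed

lemma chart_U_pair: "z \<in> chart_U {i, j} \<Longrightarrow> z \<in> chart_U {i} \<and> z \<in> chart_U {j}"
  by (auto simp: chart_U_def)

lemma chart_U_subset: "chart_U I \<subseteq> U"
  by (auto simp: chart_U_def)

text \<open>The charts 12 and 14 lie in \<open>y \<noteq> 0\<close>, the charts 23 and 34 in \<open>x \<noteq> 0\<close>.\<close>

lemma chart_U_branch_dom:
  assumes "i < 4" shows "chart_U {i} \<subseteq> branch_dom (2 \<le> i)"
proof -
  have "i = 0 \<or> i = 1 \<or> i = 2 \<or> i = 3" using assms by linarith
  moreover have "(3::4) \<notin> face 0" "(3::4) \<notin> face 1" "(1::4) \<notin> face 2" "(1::4) \<notin> face 3"
    by (simp_all add: face_def)
  ultimately show ?thesis by (auto simp: chart_U_def branch_dom_def)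
qed

text \<open>In degree zero only singletons \<open>I\<close> occur, and \<open>2 \<le> Min I\<close>
  selects the branch whose domain contains that chart.\<close>

definition ds_lift_cochain :: "(((nat \<times> (complex^5)) set), 5) tangent cochain" where
  "ds_lift_cochain I M z = ds_lift (2 \<le> Min I) z"

lemma ds_lift_cochain_single: "ds_lift_cochain {i} M z = ds_lift (2 \<le> i) z"
  by (simp add: ds_lift_cochain_def)

text \<open>The reference lift realizes the cocycle exactly: the group part vanishes by invariance,
  the Cech part vanishes between charts of the same branch and is \<open>W\<close> across
  branches.\<close>

lemma d_tot_ds_lift:
  assumes "(I, M) \<in> tot_index (Suc 0)" "z \<in> chart_U I"
  shows "d_tot (pullback_Theta Y fibre) ds_lift_cochain I M z = dmap Y fibre z (eta_cocycle I M z)"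
  using assms(1)
proof (cases rule: tot_index_1)
  case (group i \<mu>)
  have zi: "z \<in> branch_dom (2 \<le> i)" using assms(2) chart_U_branch_dom[OF group(1)] group(3) by blast
  obtain a b where "gen \<mu> = deck a b" using gen_deck group(2) by blast
  then have "ds_lift (2 \<le> i) (gen \<mu> z) = ds_lift (2 \<le> i) z" using ds_lift_deck[OF zi] by simp
  moreover have "z \<in> U" using zi branch_dom_subset by blast
  ultimately show ?thesis
    unfolding group d_tot_group by (simp add: pullback_Theta_def eta_cocycle_def dmap_zero ds_lift_cochain_single)
next
  case (cech i j)
  have z: "z \<in> branch_dom (2 \<le> i)" "z \<in> branch_dom (2 \<le> j)"
    using chart_U_pair[of z i j] assms(2) cech chart_U_branch_dom[of i] chart_U_branch_dom[of j] by auto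
  then have zU: "z \<in> U" using branch_dom_subset by blast
  \<comment> \<open>The scalars \<open>0, 0, 1, 1\<close> are the indicator of the branch
    \<open>x \<noteq> 0\<close>.\<close>
  have cs: "chart_scalar l = (if 2 \<le> l then 1 else 0)" if "l < 4" for l
  proof -
    have "l = 0 \<or> l = 1 \<or> l = 2 \<or> l = 3" using that by linarith
    then show ?thesis by (auto simp: chart_scalar_def)
  qed
  have mm: "Max {i, j} = j" "Min {i, j} = i" using cech(1) by simp_all
  have "eta_cocycle I M z = (if \<not> 2 \<le> i \<and> 2 \<le> j then W z else 0)"
    unfolding cech(3,4) eta_cocycle_def mm using cech(1,2) by (auto simp: cs)
  moreover have "d_tot (pullback_Theta Y fibre) ds_lift_cochain I M z = ds_lift (2 \<le> j) z - ds_lift (2 \<le> i) z"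
    unfolding cech(3,4) d_tot_cech[OF cech(1)] ds_lift_cochain_single ..
  ultimately show ?thesis
    using ds_lift_diff[of z] z zU cech(1) by (cases "2 \<le> i"; cases "2 \<le> j") (auto simp: dmap_zero)
qed

lemma gen_chart_U: "\<mu> \<in> {1, 2} \<Longrightarrow> z \<in> chart_U {i} \<Longrightarrow> gen \<mu> z \<in> chart_U {i}"
  using gen_deck chart_U_deck by metis

text \<open>As \<open>dmap\<close> is fibrewise additive and commutes with the pullbacks, changing
  the reference lift by the image of \<open>a\<close> changes the resulting cocycle by the
  coboundary of \<open>a\<close>.\<close>

lemma d_tot_dmap:
  assumes "(I, M) \<in> tot_index (Suc 0)" "z \<in> chart_U I"
    and b: "\<And>i z. i < 4 \<Longrightarrow> z \<in> chart_U {i} \<Longrightarrow> b {i} {} z = ds_lift_cochain {i} {} z + dmap Y fibre z (a {i} {} z)"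
  shows "d_tot (pullback_Theta Y fibre) b I M z = dmap Y fibre z (eta_cocycle I M z + d_tot Theta a I M z)"
proof -
  have zU: "z \<in> U" using assms(2) chart_U_subset by blast
  have "d_tot (pullback_Theta Y fibre) b I M z =
      d_tot (pullback_Theta Y fibre) ds_lift_cochain I M z + dmap Y fibre z (d_tot Theta a I M z)"
    using assms(1)
  proof (cases rule: tot_index_1)
    case (group i \<mu>)
    have z: "z \<in> chart_U {i}" using assms(2) group by simp
    then have "gen \<mu> z \<in> chart_U {i}" using gen_chart_U group(2) by blast
    then show ?thesis
      unfolding group d_tot_group dmap_diff[OF zU] dmap_pull[OF zU group(2)]
      using b[OF group(1) z] b[OF group(1)] by (simp add: pullback_Theta_def)
  next
    case (cech i j)
    have z: "z \<in> chart_U {i}" "z \<in> chart_U {j}" using chart_U_pair[of z i j] assms(2) cech by auto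
    have "i < 4" using cech by simp
    then show ?thesis
      unfolding cech(3,4) d_tot_cech[OF cech(1)] dmap_diff[OF zU]
      using b[OF _ z(1)] b[OF cech(2) z(2)] by simp
  qed
  then show ?thesis unfolding d_tot_ds_lift[OF assms(1,2)] dmap_add[OF zU] .
qed

lemma dmap_section:
  assumes S: "open S" "S \<subseteq> U" and v: "v \<in> sections Theta S"
  shows "(\<lambda>z. dmap Y fibre z (v z)) \<in> sections (pullback_Theta Y fibre) S"
proof -
  have "holo_on (\<lambda>z. dmap Y fibre z (v z) d) {z \<in> S. fibre z \<in> fst d}" if d: "d \<in> atlas Y" for d
  proof (rule holo_onI)
    fix z assume z: "z \<in> {z \<in> S. fibre z \<in> fst d}"
    obtain k' V' where g: "sheetY k' V'" "d = chartY k' V'" using d by (auto simp: atlas_Y)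
    obtain a b where ab: "deck a b z \<in> V'" using fibre_chart_deck[OF g(1)] z g(2) S(2) by blast
    have ev: "\<forall>\<^sub>F w in nhds z. dmap Y fibre w (v w) d = embed5 (deck a b (v w)) 0"
      using eventually_deck[OF sheetY_D(4)[OF g(1)] ab]
      by eventually_elim (simp add: g(2) dmap_fibre[OF g(1)])
    have "holo_at (\<lambda>w. v w $ i) z" for i using v z by (auto simp: Theta_def holo_on_iff)
    then have "holo_at (\<lambda>w. embed5 (deck a b (v w)) 0 $ i) z" for i
      using exhaust_5[of i] by (auto simp: holo_at_cmult holo_at_const)
    then show "\<exists>g. (\<forall>\<^sub>F w in nhds z. dmap Y fibre w (v w) d = g w) \<and> (\<forall>i. holo_at (\<lambda>w. g w $ i) z)"
      using ev by (intro exI[of _ "\<lambda>w. embed5 (deck a b (v w)) 0"]) simp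
  qed
  then show ?thesis using S dmap_fibre_tangent unfolding pullback_Theta_def by auto
qed

lemma section_add:
  assumes "s \<in> sections (pullback_Theta Y fibre) S" "t \<in> sections (pullback_Theta Y fibre) S"
  shows "(\<lambda>z. s z + t z) \<in> sections (pullback_Theta Y fibre) S"
  using assms tangent_space_add[OF complex_manifold_Y]
  by (auto simp: pullback_Theta_def holo_on_iff intro!: holo_at_add)

text \<open>\<open>dmap\<close> reflects holomorphy: in a chart around the point, \<open>v\<close>
  consists of the first four coordinates of the difference of two holomorphic sections. This covers
  a \<open>v\<close> that is given only pointwise.\<close>

lemma section_dmap_imp_holo:
  assumes S: "open S" "S \<subseteq> U"
    and s: "s \<in> sections (pullback_Theta Y fibre) S" and t: "t \<in> sections (pullback_Theta Y fibre) S"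
    and v: "\<And>z. z \<in> S \<Longrightarrow> dmap Y fibre z (v z) = s z - t z"
  shows "v \<in> sections Theta S"
proof -
  have "holo_on v S"
  proof (rule holo_onI)
    fix z assume z: "z \<in> S"
    then obtain k V where V: "sheetY k V" "z \<in> V" using ex_chart_fibre S(2) by blast
    define d where "d = chartY k V"
    have d: "d \<in> atlas Y" "fibre z \<in> fst d"
      using V chartY_at_fibre[OF V(1), of 0 0 z] by (simp_all add: d_def charts_at_def)
    have restrict4: "v w = restrict4 (s w d + - t w d)" if "w \<in> S" "w \<in> V" for w
    proof -
      have "deck 0 0 w \<in> V" using that by simp
      from dmap_fibre[OF V(1) this, of "v w"] have "embed5 (v w) 0 = dmap Y fibre w (v w) d" by (simp add: d_def)
      then have "embed5 (v w) 0 = (s w - t w) d" by (simp only: v[OF that(1)])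
      then have "restrict4 (embed5 (v w) 0) = restrict4 ((s w - t w) d)" by simp
      then show ?thesis by simp
    qed
    have "\<forall>\<^sub>F w in nhds z. w \<in> S \<inter> V"
      using z V S(1) sheetY_D(4) by (intro eventually_in_open) auto
    then have ev: "\<forall>\<^sub>F w in nhds z. v w = restrict4 (s w d + - t w d)"
      by eventually_elim (auto simp: restrict4)
    have "holo_at (\<lambda>w. s w d $ i) z" "holo_at (\<lambda>w. t w d $ i) z" for i
      using s t d z by (auto simp: pullback_Theta_def holo_on_iff)
    then have "holo_at (\<lambda>w. s w d $ i + - t w d $ i) z" for i by (intro holo_at_add holo_at_minus)
    then have "holo_at (\<lambda>w. restrict4 (s w d + - t w d) $ i) z" for i
      using exhaust_4[of i] by auto
    then show "\<exists>g. (\<forall>\<^sub>F w in nhds z. v w = g w) \<and> (\<forall>i. holo_at (\<lambda>w. g w $ i) z)"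
      using ev by (intro exI[of _ "\<lambda>w. restrict4 (s w d + - t w d)"]) simp
  qed
  then show ?thesis by (simp add: Theta_def)
qed

section \<open>Comparison of the two cohomology classes\<close>

lemma ds_lift_cochain_section:
  "i < 4 \<Longrightarrow> ds_lift_cochain {i} {} \<in> sections (pullback_Theta Y fibre) (chart_U {i})"
  using ds_lift_section[OF chart_U_branch_dom] by (simp add: ds_lift_cochain_single[abs_def])

text \<open>Lifts \<open>b\<close> of the base field and cochains \<open>a\<close> of vector fields
  correspond by \<open>b = ds_lift_cochain + dmap a\<close>. Under this correspondence the condition
  defining the connecting homomorphism becomes membership in the coset of
  \<open>eta_cocycle\<close>.\<close>

lemma KS_eq_eta: "KS Y 1 family_proj central_incl (d_ds 1) = eta"
proof (intro equalityI subsetI)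
  fix c assume "c \<in> KS Y 1 family_proj central_incl (d_ds 1)"
  then obtain b where c: "c \<in> cocycles Theta (Suc 0)" and b: "b \<in> cochains (pullback_Theta Y fibre) 0"
    and \<beta>: "cochain_eq 0 (\<lambda>I M z. family_dproj z (b I M z)) (\<lambda>I M z. d_ds 1)"
    and \<alpha>: "cochain_eq (Suc 0) (\<lambda>I M z. dmap Y fibre z (c I M z)) (d_tot (pullback_Theta Y fibre) b)"
    unfolding KS_def connecting_def by auto
  have bs: "b {i} {} \<in> sections (pullback_Theta Y fibre) (chart_U {i})" if "i < 4" for i
    using b that tot_index_0[of "{i}" "{}"] by (auto simp: cochains_def)
  \<comment> \<open>The preimage is selected point by point; its holomorphy follows afterwards from
    that of the two lifts.\<close>
  define a where "a = (\<lambda>I M z. SOME v. dmap Y fibre z v = b I M z - ds_lift_cochain I M z)"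
  have a: "dmap Y fibre z (a {i} {} z) = b {i} {} z - ds_lift_cochain {i} {} z"
    if i: "i < 4" and z: "z \<in> chart_U {i}" for i z
  proof -
    have "family_dproj z (b {i} {} z) = d_ds 1" using \<beta> i z tot_index_0[of "{i}" "{}"] by (auto simp: cochain_eq_def)
    moreover have "b {i} {} z \<in> tangent_space Y (fibre z)" using bs[OF i] z by (simp add: pullback_Theta_def)
    moreover have "z \<in> branch_dom (2 \<le> i)" using z chart_U_branch_dom[OF i] by blast
    ultimately have "\<exists>v. dmap Y fibre z v = b {i} {} z - ds_lift_cochain {i} {} z"
      unfolding ds_lift_cochain_single using family_dproj_exact by metis
    then show ?thesis unfolding a_def by (rule someI_ex)
  qed
  have "a \<in> cochains Theta 0"
    unfolding cochains_def
  proof (clarsimp simp: tot_index_0)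
    fix i :: nat assume i: "i < 4"
    show "a {i} {} \<in> sections Theta (chart_U {i})"
      by (rule section_dmap_imp_holo[OF open_chart_U chart_U_subset bs[OF i] ds_lift_cochain_section[OF i] a[OF i]])
  qed
  moreover have "cochain_eq (Suc 0) c (\<lambda>I M z. eta_cocycle I M z + d_tot Theta a I M z)"
    unfolding cochain_eq_def
  proof (clarify)
    fix I M z assume I: "(I, M) \<in> tot_index (Suc 0)" and z: "z \<in> chart_U I"
    have "dmap Y fibre z (c I M z) = d_tot (pullback_Theta Y fibre) b I M z"
      using \<alpha> I z by (auto simp: cochain_eq_def)
    also have "\<dots> = dmap Y fibre z (eta_cocycle I M z + d_tot Theta a I M z)"
      by (rule d_tot_dmap[OF I z]) (simp add: a)
    finally show "c I M z = eta_cocycle I M z + d_tot Theta a I M z"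
      using z chart_U_subset by (blast intro: dmap_inj)
  qed
  ultimately show "c \<in> eta" using c unfolding eta_def coh_class_def by blast
next
  fix c assume "c \<in> eta"
  then obtain a where c: "c \<in> cocycles Theta (Suc 0)" and a: "a \<in> cochains Theta 0"
    and eq: "cochain_eq (Suc 0) c (\<lambda>I M z. eta_cocycle I M z + d_tot Theta a I M z)"
    unfolding eta_def coh_class_def by auto
  have as: "a {i} {} \<in> sections Theta (chart_U {i})" if "i < 4" for i
    using a that tot_index_0[of "{i}" "{}"] by (auto simp: cochains_def)
  define b where "b = (\<lambda>I M z. ds_lift_cochain I M z + dmap Y fibre z (a I M z))"
  have "b \<in> cochains (pullback_Theta Y fibre) 0"
    unfolding cochains_def
  proof (clarsimp simp: tot_index_0)
    fix i :: nat assume i: "i < 4"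
    show "b {i} {} \<in> sections (pullback_Theta Y fibre) (chart_U {i})"
      unfolding b_def
      by (rule section_add[OF ds_lift_cochain_section[OF i] dmap_section[OF open_chart_U chart_U_subset as[OF i]]])
  qed
  moreover have "cochain_eq 0 (\<lambda>I M z. family_dproj z (b I M z)) (\<lambda>I M z. d_ds 1)"
    unfolding cochain_eq_def
  proof (clarsimp simp: tot_index_0 simp del: o_apply)
    fix i :: nat and z assume "i < 4" "z \<in> chart_U {i}"
    then have "z \<in> branch_dom (2 \<le> i)" using chart_U_branch_dom by blast
    then show "family_dproj z (b {i} {} z) = d_ds 1"
      unfolding b_def ds_lift_cochain_single by (rule family_dproj_ds_lift_add)
  qed
  moreover have "cochain_eq (Suc 0) (\<lambda>I M z. dmap Y fibre z (c I M z)) (d_tot (pullback_Theta Y fibre) b)"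
    unfolding cochain_eq_def
  proof (clarify)
    fix I M z assume I: "(I, M) \<in> tot_index (Suc 0)" and z: "z \<in> chart_U I"
    have "c I M z = eta_cocycle I M z + d_tot Theta a I M z" using eq I z by (auto simp: cochain_eq_def)
    moreover have "d_tot (pullback_Theta Y fibre) b I M z = dmap Y fibre z (eta_cocycle I M z + d_tot Theta a I M z)"
      by (rule d_tot_dmap[OF I z]) (simp add: b_def)
    ultimately show "dmap Y fibre z (c I M z) = d_tot (pullback_Theta Y fibre) b I M z" by simp
  qed
  ultimately show "c \<in> KS Y 1 family_proj central_incl (d_ds 1)"
    using c unfolding KS_def connecting_def o_def by blast
qed

theorem proposition21p6:
  shows "\<exists>(Y :: ((nat \<times> (complex^5)) set, 5) cmanifold) (r::real) p \<iota>.
           r > 0 \<and>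
           holomorphic_submersion Y (disk r) p \<and>
           proper_map (mtop Y) (mtop (disk r)) p \<and>
           holomorphic_embedding X Y \<iota> \<and>
           \<iota> ` topspace (mtop X) = {y \<in> topspace (mtop Y). p y = 0} \<and>
           KS Y r p \<iota> (d_ds r) = eta"
proof (intro exI conjI)
  \<comment> \<open>The flow of \<open>W\<close> exists for all times, so nothing forces a small
    disk.\<close>
  show "(1::real) > 0" by simp
  show "holomorphic_submersion Y (disk 1) family_proj" by (rule holomorphic_submersion_family_proj)
  show "proper_map (mtop Y) (mtop (disk 1)) family_proj" using proper_map_family_proj by simp
  show "holomorphic_embedding X Y central_incl" by (rule holomorphic_embedding_central_incl)
  show "central_incl ` topspace (mtop X) = {y \<in> topspace (mtop Y). family_proj y = 0}" using central_incl_image by simp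
  show "KS Y 1 family_proj central_incl (d_ds 1) = eta" by (rule KS_eq_eta)
qed

end
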